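(* Let $a,b,c,\mu\in\mathbb{C}$. In each identity below assume that the arguments of the three gamma functions in the numerator on the right-hand side have positive real parts, and that the lower (third) parameters of the hypergeometric functions in the two $w_j$'s occurring are not in $\mathbb{Z}_{\le0}$. (1) For $x\in(-\infty,0)\cup(1,\infty)$: $$\int_0^1y^{c-1}(1-y)^{b-c-\mu}w_1(y;a,b,c)|x-y|^{\mu-1}dy=\frac{\Gamma(-a-\mu+1)\Gamma(b-c-\mu+1)\Gamma(c)}{\Gamma(b-a-\mu+1)\Gamma(1-\mu)}|x|^{c+\mu-1}|x-1|^{b-c}w_4(x;a+\mu,b,c+\mu).$$ (2) For $x\in(-\infty,0)\cup(0,1)$: $$\int_1^\infty y^{c-1}(y-1)^{b-c-\mu}w_3(y;a,b,c)(y-x)^{\mu-1}dy=\frac{\Gamma(-a-\mu+1)\Gamma(b-c-\mu+1)\Gamma(a-b+1)}{\Gamma(-c-\mu+2)\Gamma(1-\mu)}|x|^{c+\mu-1}|x-1|^{b-c}w_2(x;a+\mu,b,c+\mu).$$ (3) For $x\in(-\infty,0)\cup(1,\infty)$: $$\int_0^1y^{c-1}(1-y)^{a-c-\mu}w_1(y;a,b,c)|x-y|^{\mu-1}dy=\frac{\Gamma(-b-\mu+1)\Gamma(a-c-\mu+1)\Gamma(c)}{\Gamma(a-b-\mu+1)\Gamma(1-\mu)}|x|^{c+\mu-1}|x-1|^{a-c}w_3(x;a,b+\mu,c+\mu).$$ (4) For $x\in(-\infty,0)\cup(0,1)$: $$\int_1^\infty y^{c-1}(y-1)^{a-c-\m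u}w_4(y;a,b,c)|x-y|^{\mu-1}dy=\frac{\Gamma(-b-\mu+1)\Gamma(a-c-\mu+1)\Gamma(b-a+1)}{\Gamma(-c-\mu+2)\Gamma(1-\mu)}|x|^{c+\mu-1}|x-1|^{a-c}w_2(x;a,b+\mu,c+\mu).$$
   Context: Write $F(a,b;c;z)={}_2F_1(a,b;c;z)$ for the Gauss hypergeometric function (power series for $|z|<1$, analytically continued to $\mathbb{C}\setminus[1,\infty)$, with $c\notin\mathbb{Z}_{\le0}$). Define $w_1(x;a,b,c)=F(a,b;c;x)$ for $x\in(-\infty,1)$; $w_2(x;a,b,c)=|x|^{1-c}F(a-c+1,b-c+1;2-c;x)$ for $x\in(-\infty,0)\cup(0,1)$; $w_3(x;a,b,c)=|x|^{-a}F(a,a-c+1;a-b+1;x^{-1})$ for $x\in(-\infty,0)\cup(1,\infty)$; $w_4(x;a,b,c)=|x|^{-b}F(b,b-c+1;b-a+1;x^{-1})$ for $x\in(-\infty,0)\cup(1,\infty)$. Convention: $1/\Gamma$ is entire, with value $0$ at nonpositive integers. *)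

theory Defs
  imports "HOL-Complex_Analysis.Complex_Analysis"
begin

definition is_hyp2F1_continuation :: "complex \<Rightarrow> complex \<Rightarrow> complex \<Rightarrow> (complex \<Rightarrow> complex) \<Rightarrow> bool" where
  "is_hyp2F1_continuation a b c f \<longleftrightarrow>
     f holomorphic_on (- complex_of_real ` {1..}) \<and>
     (\<forall>z. norm z < 1 \<longrightarrow> f z = eval_fps (fps_hypergeo [a, b] [c] 1) z)"

lemma eval_fps_hypergeo_2_1:
  "eval_fps (fps_hypergeo [a, b] [c] 1) z =
     (\<Sum>n. pochhammer a n * pochhammer b n / (pochhammer c n * fact n) * z ^ n)"
  for a b c z :: complex
  by (simp add: eval_fps_def)

text \<open>The slit plane is connected, so the continuation is unique there; the values on the
  cut \<open>[1,\<infinity>)\<close> are unspecified. The function is only meaningful when \<open>c\<close> is not a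
  nonpositive integer.\<close>

definition hyp2F1 :: "complex \<Rightarrow> complex \<Rightarrow> complex \<Rightarrow> complex \<Rightarrow> complex" where
  "hyp2F1 a b c = (SOME f. is_hyp2F1_continuation a b c f)"

text \<open>The functions below are meaningful on \<open>(-\<infinity>,1)\<close>, \<open>(-\<infinity>,0) \<union> (0,1)\<close>,
  \<open>(-\<infinity>,0) \<union> (1,\<infinity>)\<close> and \<open>(-\<infinity>,0) \<union> (1,\<infinity>)\<close>, respectively.\<close>

definition w1 :: "real \<Rightarrow> complex \<Rightarrow> complex \<Rightarrow> complex \<Rightarrow> complex" where
  "w1 x a b c = hyp2F1 a b c (of_real x)"

definition w2 :: "real \<Rightarrow> complex \<Rightarrow> complex \<Rightarrow> complex \<Rightarrow> complex" where
  "w2 x a b c = of_real \<bar>x\<bar> powr (1 - c) * hyp2F1 (a - c + 1) (b - c + 1) (2 - c) (of_real x)"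

definition w3 :: "real \<Rightarrow> complex \<Rightarrow> complex \<Rightarrow> complex \<Rightarrow> complex" where
  "w3 x a b c = of_real \<bar>x\<bar> powr (- a) * hyp2F1 a (a - c + 1) (a - b + 1) (of_real (inverse x))"

definition w4 :: "real \<Rightarrow> complex \<Rightarrow> complex \<Rightarrow> complex \<Rightarrow> complex" where
  "w4 x a b c = of_real \<bar>x\<bar> powr (- b) * hyp2F1 b (b - c + 1) (b - a + 1) (of_real (inverse x))"

text \<open>An identity between a Lebesgue integral and a value, including absolute convergence
  (the Bochner integral of a non-integrable function is \<open>0\<close>).\<close>

definition has_lebesgue_integral_on :: "(real \<Rightarrow> complex) \<Rightarrow> complex \<Rightarrow> real set \<Rightarrow> bool" where
  "has_lebesgue_integral_on f I S \<longleftrightarrow>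
     set_integrable lborel S f \<and> set_lebesgue_integral lborel S f = I"

end

theory Submission
  imports Defs
begin

text \<open>
  Put \<open>t = 1 - y\<close> and \<open>z = 1 / (1 - x)\<close>, so that \<open>|x - y| = |x - 1| (1 - z t)\<close>. The first integral becomes
  \<open>|x - 1|^(\<mu>-1)\<close> times \<open>\<integral> g(t) (1 - z t)^(\<mu>-1) dt\<close> over the unit interval, where
  \<open>g(t) = t^(b-c-\<mu>) (1-t)^(c-1) F(a,b;c;1-t)\<close>. For every integrable \<open>g\<close> such an integral is holomorphic
  in \<open>z\<close> off the cut \<open>[1,\<infinity>)\<close>, and its Taylor coefficients at \<open>0\<close> are the moments of \<open>g\<close>
  times \<open>(1-\<mu>)_n / n!\<close>. Here the moments are ratios of Gamma values, by termwise Beta integrals and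
  Gauss' summation of \<open>F(a,b;c;1)\<close>, so the integral is a multiple of
  \<open>F(1-a-\<mu>, b-c-\<mu>+1; b-a-\<mu>+1; z)\<close>, and Pfaff's transformation turns this into \<open>w4\<close>.
  The second identity is the first one under \<open>y \<mapsto> 1/y\<close>, with \<open>(b, c, x)\<close> replaced by
  \<open>(a-c+1, a-b+1, 1/x)\<close>; the other two follow from the symmetry of \<open>F\<close> in its upper parameters.
\<close>

section \<open>Integrals depending holomorphically on a parameter\<close>

text \<open>Why the answer is again a 2F1: expanding \<open>(1 - z t) powr (\<mu> - 1)\<close>
  contributes (1-\<mu>)_n, and the exponent \<open>b - c - \<mu>\<close> is tuned so that the n-th
  moment contains the factor 1/Gamma(1-\<mu>+n). Their product is 1/Gamma(1-\<mu>) for every n, so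
  an expected 3F2 collapses. For \<mu> a positive integer both sides are therefore 0, which is why
  reciprocal Gamma functions are used. The obstacle is the range of z. It lies in (0,1) for x < 0,
  but is negative for x > 1, with |z| \<ge> 1 when 1 < x \<le> 2. No expansion at 0 converges on all
  of that range, so both sides are compared as holomorphic functions on the slit plane and only
  their Taylor coefficients at 0 are computed. This needs \<open>hyp2F1\<close>, which is introduced
  by choice, to be holomorphic there for every admissible c. Euler's integral proves that only for 0
  < Re b < Re c; contiguous relations supply the remaining parameters. All complex powers of real
  quantities have positive bases, so the prefactors are compared as exponentials of real
  logarithms.\<close>

lemma holomorphic_bounded_imp_difference_quotient_le:
  fixes h :: "complex \<Rightarrow> complex"
  assumes h: "h holomorphic_on cball z r" and r: "r > 0"
    and B: "\<And>w. w \<in> cball z r \<Longrightarrow> norm (h w) \<le> B"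
    and w: "w \<in> ball z (r/2)" "w \<noteq> z"
  shows "norm ((h w - h z) / (w - z)) \<le> 2 * B / r"
proof -
  \<comment> \<open>Halving the radius leaves room for a disc of radius \<open>r/2\<close> about
    \<open>v\<close> inside \<open>cball z r\<close>, so Cauchy's inequality bounds the derivative
    by B/(r/2). The mean value inequality on the convex \<open>ball z (r/2)\<close> then bounds the
    quotient.\<close>
  have deriv_le: "norm (deriv h v) \<le> 2 * B / r" if v: "v \<in> ball z (r/2)" for v
  proof -
    have sub: "cball v (r/2) \<subseteq> cball z r"
    proof
      fix x assume "x \<in> cball v (r/2)"
      thus "x \<in> cball z r" using v dist_triangle[of z x v] by auto
    qed
    have "norm ((deriv ^^ 1) h v) \<le> fact 1 * B / (r/2) ^ 1"
    proof (rule Cauchy_inequality)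
      show "h holomorphic_on ball v (r/2)"
        using h sub ball_subset_cball by (meson holomorphic_on_subset subset_trans)
      show "continuous_on (cball v (r/2)) h"
        using h sub holomorphic_on_imp_continuous_on holomorphic_on_subset by blast
      show "norm (h x) \<le> B" if "norm (v - x) = r/2" for x
        using that sub by (intro B) (auto simp: dist_norm)
    qed (use r in auto)
    thus ?thesis by (simp add: field_simps)
  qed
  have "norm (h w - h z) \<le> 2 * B / r * norm (w - z)"
  proof (rule field_differentiable_bound[of "ball z (r/2)"])
    show "(h has_field_derivative deriv h v) (at v within ball z (r/2))"
      if "v \<in> ball z (r/2)" for v
    proof -
      have "v \<in> ball z r" using that r by auto
      moreover have "h holomorphic_on ball z r"
        using h ball_subset_cball holomorphic_on_subset by blast
      ultimately show ?thesis
        using holomorphic_derivI[of h "ball z r" v] by (meson has_field_derivative_at_within open_ball)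
    qed
  qed (use w r deriv_le in auto)
  with w(2) show ?thesis by (simp add: norm_divide field_simps)
qed

text \<open>Differentiation under the integral sign. By Cauchy's inequality a local integrable
  majorant of \<open>f\<close> itself also dominates the difference quotients, so no bound on the
  derivative has to be supplied.\<close>

theorem holomorphic_on_lebesgue_integral:
  fixes f :: "complex \<Rightarrow> 'a \<Rightarrow> complex"
  assumes S: "open S"
    and meas: "\<And>z. z \<in> S \<Longrightarrow> f z \<in> borel_measurable M"
    and holo: "\<And>t. t \<in> space M \<Longrightarrow> (\<lambda>z. f z t) holomorphic_on S"
    and dom: "\<And>z. z \<in> S \<Longrightarrow> \<exists>r>0. \<exists>g. integrable M g \<and>
                 (\<forall>w\<in>S \<inter> cball z r. \<forall>t\<in>space M. norm (f w t) \<le> g t)"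
  shows "(\<lambda>z. \<integral>t. f z t \<partial>M) holomorphic_on S"
  unfolding holomorphic_on_open[OF S]
proof
  fix z assume z: "z \<in> S"
  from dom[OF z] obtain r1 g where r1: "r1 > 0" and g: "integrable M g"
    and bd: "\<And>w t. w \<in> S \<inter> cball z r1 \<Longrightarrow> t \<in> space M \<Longrightarrow> norm (f w t) \<le> g t" by blast
  obtain r2 where r2: "r2 > 0" "cball z r2 \<subseteq> S"
    using S z open_contains_cball by blast
  define r where "r = min r1 r2"
  have r: "r > 0" "cball z r \<subseteq> S" "cball z r \<subseteq> cball z r1"
    using r1 r2 by (auto simp: r_def)
  have int: "integrable M (f w)" if "w \<in> cball z r" for w
    using that r meas[of w] bd[of w]
    by (intro Bochner_Integration.integrable_bound[OF g]) (force intro!: AE_I2 order_trans[OF _ abs_ge_self])+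
  define D where "D = (\<lambda>t. deriv (\<lambda>z. f z t) z)"
  have "((\<lambda>w. ((\<integral>t. f w t \<partial>M) - (\<integral>t. f z t \<partial>M)) / (w - z)) \<longlongrightarrow> (\<integral>t. D t \<partial>M)) (at z)"
    \<comment> \<open>Dominated convergence concerns sequences, so the limit is tested along an
      arbitrary sequence; \<open>Y\<close> is a tail of it that stays in the half-radius
      disc.\<close>
    unfolding tendsto_at_iff_sequentially comp_def
  proof (intro allI impI)
    fix X :: "nat \<Rightarrow> complex"
    assume X: "\<forall>i. X i \<in> UNIV - {z}" "X \<longlonglongrightarrow> z"
    obtain N where N: "\<And>n. n \<ge> N \<Longrightarrow> X n \<in> ball z (r/2)"
      using X(2) r(1) by (metis (no_types, lifting) dist_commute half_gt_zero lim_sequentially mem_ball)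
    define Y where "Y = (\<lambda>n. X (n + N))"
    have Y: "Y n \<in> ball z (r/2)" "Y n \<noteq> z" "Y n \<in> cball z r" "Y n \<in> S" for n
    proof -
      show *: "Y n \<in> ball z (r/2)" "Y n \<noteq> z" using N X by (auto simp: Y_def)
      show "Y n \<in> cball z r" using * r(1) by auto
      thus "Y n \<in> S" using r by auto
    qed
    have Yz: "Y \<longlonglongrightarrow> z" unfolding Y_def by (rule LIMSEQ_ignore_initial_segment) fact
    have zS: "z \<in> cball z r" using r by auto
    define q where "q = (\<lambda>n t. (f (Y n) t - f z t) / (Y n - z))"
    have qm: "q n \<in> borel_measurable M" for n
      using meas[OF Y(4)] meas[OF z] by (auto simp: q_def)
    have lim: "(\<lambda>n. q n t) \<longlonglongrightarrow> D t" if t: "t \<in> space M" for t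
    proof -
      have "((\<lambda>z. f z t) has_field_derivative D t) (at z)"
        unfolding D_def using holo[OF t] S z by (rule holomorphic_derivI)
      hence "((\<lambda>w. (f w t - f z t) / (w - z)) \<longlongrightarrow> D t) (at z)"
        by (simp add: has_field_derivative_iff)
      thus ?thesis unfolding tendsto_at_iff_sequentially comp_def q_def
        using Y Yz by auto
    qed
    have "(\<lambda>n. \<integral>t. q n t \<partial>M) \<longlonglongrightarrow> (\<integral>t. D t \<partial>M)"
    proof (rule integral_dominated_convergence[where w = "\<lambda>t. 2 * g t / r"])
      show "D \<in> borel_measurable M" by (rule borel_measurable_LIMSEQ_metric[OF qm lim])
      show "integrable M (\<lambda>t. 2 * g t / r)" using g by auto
      show "AE t in M. norm (q n t) \<le> 2 * g t / r" for n
      proof (rule AE_I2)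
        fix t assume t: "t \<in> space M"
        show "norm (q n t) \<le> 2 * g t / r" unfolding q_def
          by (rule holomorphic_bounded_imp_difference_quotient_le[of "\<lambda>z. f z t"])
             (use t r Y bd holo[OF t] in \<open>auto intro: holomorphic_on_subset simp: subset_iff\<close>)
      qed
    qed (use qm lim in auto)
    moreover have "(\<integral>t. q n t \<partial>M) = ((\<integral>t. f (Y n) t \<partial>M) - (\<integral>t. f z t \<partial>M)) / (Y n - z)" for n
      using int[OF Y(3)] int[OF zS] by (simp add: q_def)
    ultimately have "(\<lambda>n. ((\<integral>t. f (Y n) t \<partial>M) - (\<integral>t. f z t \<partial>M)) / (Y n - z)) \<longlonglongrightarrow> (\<integral>t. D t \<partial>M)"
      by simp
    thus "(\<lambda>n. ((\<integral>t. f (X n) t \<partial>M) - (\<integral>t. f z t \<partial>M)) / (X n - z)) \<longlonglongrightarrow> (\<integral>t. D t \<partial>M)"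
      unfolding Y_def by (rule LIMSEQ_offset)
  qed
  thus "\<exists>f'. ((\<lambda>z. \<integral>t. f z t \<partial>M) has_field_derivative f') (at z)"
    by (auto simp: has_field_derivative_iff)
qed

section \<open>The slit plane and integrals of (1 - z t)^(-s) over the unit interval\<close>

definition slit_plane :: "complex set" where
  "slit_plane = - complex_of_real ` {1..}"

text \<open>Restricting the measure, rather than inserting indicator functions, lets pointwise
  hypotheses range over the open interval only, where \<open>t\<close> and \<open>1 - t\<close> are
  positive bases for complex powers.\<close>

abbreviation lborel01 :: "real measure" where
  "lborel01 \<equiv> restrict_space lborel {0<..<1}"

lemma mem_slit_plane_iff: "z \<in> slit_plane \<longleftrightarrow> Im z \<noteq> 0 \<or> Re z < 1"
  by (force simp: slit_plane_def image_iff complex_eq_iff)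

lemma one_minus_slit_plane: "z \<in> slit_plane \<Longrightarrow> 1 - z \<notin> \<real>\<^sub>\<le>\<^sub>0"
  unfolding mem_slit_plane_iff by (auto simp: complex_nonpos_Reals_iff)

text \<open>The slit plane is star-shaped about 0. This gives its connectedness and also keeps
  \<open>1 - z * t\<close> off the branch cut of the power for all \<open>t\<close> between 0 and
  1.\<close>

lemma slit_plane_mult_real:
  assumes "z \<in> slit_plane" "0 \<le> t" "t \<le> 1"
  shows   "z * of_real t \<in> slit_plane"
proof -
  have "Re z * t < 1" if "Re z < 1"
    using that assms by (metis less_eq_real_def linorder_not_less mult.commute mult_left_le mult_nonpos_nonneg order.strict_trans1 zero_less_one nle_le)
  thus ?thesis using assms unfolding mem_slit_plane_iff by auto
qed

lemma open_slit_plane: "open slit_plane"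
proof -
  have "closed (complex_of_real ` {1..})"
    by (rule closed_injective_linear_image)
       (auto intro!: injI bounded_linear.linear bounded_linear_of_real)
  thus ?thesis by (simp add: open_Compl slit_plane_def)
qed

lemma connected_slit_plane: "connected slit_plane"
proof -
  have "starlike slit_plane"
    unfolding starlike_def
  proof (intro bexI[of _ 0] ballI)
    fix z assume z: "z \<in> slit_plane"
    show "closed_segment 0 z \<subseteq> slit_plane"
    proof
      fix w assume "w \<in> closed_segment 0 z"
      then obtain u where "0 \<le> u" "u \<le> 1" "w = z * of_real u"
        by (auto simp: closed_segment_def scaleR_conv_of_real mult.commute)
      thus "w \<in> slit_plane" using slit_plane_mult_real[OF z] by simp
    qed
  qed (simp add: mem_slit_plane_iff)
  thus ?thesis by (rule starlike_imp_connected)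
qed

text \<open>A common Taylor series at 0 forces equality near 0, and connectedness carries it to the
  whole slit plane. Every continuation argument about \<open>hyp2F1\<close> is thereby reduced to an
  identity of formal power series.\<close>

lemma holomorphic_slit_plane_eqI:
  assumes "f holomorphic_on slit_plane" "g holomorphic_on slit_plane"
    and "f has_fps_expansion F" "g has_fps_expansion F" "z \<in> slit_plane"
  shows "f z = g z"
proof -
  have "eventually (\<lambda>z. eval_fps F z = f z) (nhds 0)" "eventually (\<lambda>z. eval_fps F z = g z) (nhds 0)"
    using assms by (auto simp: has_fps_expansion_def)
  hence "eventually (\<lambda>z. f z = g z) (nhds 0)" by eventually_elim auto
  then obtain U where U: "open U" "0 \<in> U" "\<And>z. z \<in> U \<Longrightarrow> f z = g z"
    by (auto simp: eventually_nhds)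
  show ?thesis
  proof (rule analytic_continuation_open[of "U \<inter> slit_plane" slit_plane f g])
    show "U \<inter> slit_plane \<noteq> {}" using U by (auto simp: mem_slit_plane_iff intro!: exI[of _ 0])
  qed (use assms U open_slit_plane connected_slit_plane in auto)
qed

lemma gbinomial_minus_eq_pochhammer:
  "((- s) gchoose n) * (- 1) ^ n = pochhammer s n / fact n" for s :: complex
  by (simp add: gbinomial_pochhammer)

lemma sums_one_minus_powr:
  fixes z s :: complex
  assumes "norm z < 1"
  shows "(\<lambda>n. pochhammer s n / fact n * z ^ n) sums (1 - z) powr (- s)"
    and "summable (\<lambda>n. norm (pochhammer s n / fact n * z ^ n))"
proof -
  have *: "((- s) gchoose n) * (- z) ^ n = pochhammer s n / fact n * z ^ n" for n z
    by (subst power_minus) (simp add: gbinomial_minus_eq_pochhammer flip: mult.assoc)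
  have sums: "(\<lambda>n. pochhammer s n / fact n * z ^ n) sums (1 - z) powr (- s)"
    if "norm z < 1" for z
    using gen_binomial_complex[of "- z" "- s"] that by (simp add: *)
  from sums[OF assms] show "(\<lambda>n. pochhammer s n / fact n * z ^ n) sums (1 - z) powr (- s)" .
  \<comment> \<open>Convergence at one radius strictly beyond |z| yields absolute convergence at
    \<open>z\<close>.\<close>
  obtain r where r: "norm z < r" "r < 1" using assms dense by blast
  have "summable (\<lambda>n. pochhammer s n / fact n * (of_real r :: complex) ^ n)"
    by (rule sums_summable[OF sums]) (use r norm_ge_zero[of z] in \<open>auto simp del: norm_ge_zero\<close>)
  thus "summable (\<lambda>n. norm (pochhammer s n / fact n * z ^ n))"
    by (rule powser_insidea) (use r norm_ge_zero[of z] in \<open>auto simp del: norm_ge_zero\<close>)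
qed

lemma borel_measurable_lborel01I:
  fixes f :: "real \<Rightarrow> complex"
  assumes "continuous_on {0<..<1} f"
  shows "f \<in> borel_measurable lborel01"
proof -
  have "f \<in> borel_measurable (restrict_space borel {0<..<1})"
    using assms by (rule borel_measurable_continuous_on_restrict)
  thus ?thesis by (simp cong: measurable_cong_sets add: sets_restrict_space)
qed

lemma space_lborel01: "space lborel01 = {0<..<1}"
  by (simp add: space_restrict_space)

lemma continuous_on_powr_complex_slit:
  fixes f g :: "'a :: topological_space \<Rightarrow> complex"
  assumes "\<And>x. x \<in> A \<Longrightarrow> f x \<notin> \<real>\<^sub>\<le>\<^sub>0" "continuous_on A f" "continuous_on A g"
  shows "continuous_on A (\<lambda>x. f x powr g x)"
  using assms unfolding continuous_on_def by (auto intro!: tendsto_powr_complex)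

context
  fixes g :: "real \<Rightarrow> complex" and s :: complex
  assumes g: "integrable lborel01 g"
begin

lemma continuous_on_slit_kernel:
  "continuous_on (slit_plane \<times> {0..1}) (\<lambda>(z, t). (1 - z * complex_of_real t) powr (- s))"
  unfolding case_prod_unfold
proof (intro continuous_on_powr_complex_slit continuous_intros)
  fix x assume "x \<in> slit_plane \<times> {0..1::real}"
  thus "1 - fst x * complex_of_real (snd x) \<notin> \<real>\<^sub>\<le>\<^sub>0"
    by (intro one_minus_slit_plane slit_plane_mult_real) auto
qed

lemma measurable_slit_kernel:
  assumes "z \<in> slit_plane"
  shows "(\<lambda>t. (1 - z * of_real t) powr (- s)) \<in> borel_measurable lborel01"
proof (rule borel_measurable_lborel01I)
  have "continuous_on {0<..<1} (\<lambda>t. (\<lambda>(z, t). (1 - z * complex_of_real t) powr (- s)) (z, t))"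
    by (rule continuous_on_compose2[OF continuous_on_slit_kernel])
       (use assms in \<open>auto intro!: continuous_intros\<close>)
  thus "continuous_on {0<..<1} (\<lambda>t. (1 - z * complex_of_real t) powr (- s))" by simp
qed

text \<open>The kernel is jointly continuous on the compact set
  \<open>cball z r \<times> {0..1}\<close>, hence bounded there by some \<open>B\<close>, and
  \<open>norm (g t) * B\<close> is the majorant. The endpoints of the interval are included for the
  sake of compactness.\<close>

lemma slit_kernel_dominated:
  assumes z: "z \<in> slit_plane"
  shows "\<exists>r>0. \<exists>h. integrable lborel01 h \<and> (\<forall>w\<in>slit_plane \<inter> cball z r. \<forall>t\<in>space lborel01.
           norm (g t * (1 - w * of_real t) powr (- s)) \<le> h t)"
proof -
  obtain r where r: "r > 0" "cball z r \<subseteq> slit_plane"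
    using open_slit_plane z open_contains_cball by blast
  have "compact ((\<lambda>(z, t). (1 - z * complex_of_real t) powr (- s)) ` (cball z r \<times> {0..1}))"
    by (intro compact_continuous_image continuous_on_subset[OF continuous_on_slit_kernel] compact_Times)
       (use r in auto)
  hence "bounded ((\<lambda>(z, t). (1 - z * complex_of_real t) powr (- s)) ` (cball z r \<times> {0..1}))"
    by (rule compact_imp_bounded)
  then obtain B where B: "\<And>w t. w \<in> cball z r \<Longrightarrow> t \<in> {0..1} \<Longrightarrow>
      norm ((1 - w * complex_of_real t) powr (- s)) \<le> B"
    unfolding bounded_iff by fast
  show ?thesis
    using r(1) g B by (intro exI[of _ r] exI[of _ "\<lambda>t. norm (g t) * B"] conjI)
      (auto simp: norm_mult space_lborel01 intro!: mult_left_mono)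
qed

lemma integrable_slit_kernel:
  assumes z: "z \<in> slit_plane"
  shows "integrable lborel01 (\<lambda>t. g t * (1 - z * of_real t) powr (- s))"
proof -
  from slit_kernel_dominated[OF z] obtain r h where r: "r > 0" and h: "integrable lborel01 h"
    and bd: "\<forall>w\<in>slit_plane \<inter> cball z r. \<forall>t\<in>space lborel01.
           norm (g t * (1 - w * of_real t) powr (- s)) \<le> h t" by blast
  show ?thesis
  proof (rule Bochner_Integration.integrable_bound[OF h])
    show "(\<lambda>t. g t * (1 - z * complex_of_real t) powr (- s)) \<in> borel_measurable lborel01"
      using measurable_slit_kernel[OF z] g by (intro borel_measurable_times) auto
    show "AE t in lborel01. norm (g t * (1 - z * complex_of_real t) powr (- s)) \<le> norm (h t)"
      by (rule AE_I2) (use bd z r in \<open>force intro: order_trans[OF _ abs_ge_self]\<close>)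
  qed
qed

text \<open>The weight \<open>g\<close> is left arbitrary because two weights occur: the Beta
  density of Euler's integral and the \<open>w1_kernel\<close> of the transform.\<close>

lemma holomorphic_slit_kernel:
  "(\<lambda>z. \<integral>t. g t * (1 - z * of_real t) powr (- s) \<partial>lborel01) holomorphic_on slit_plane"
proof (rule holomorphic_on_lebesgue_integral[OF open_slit_plane _ _ slit_kernel_dominated])
  show "(\<lambda>z. g t * (1 - z * complex_of_real t) powr (- s)) holomorphic_on slit_plane"
    if "t \<in> space lborel01" for t
    using that slit_plane_mult_real one_minus_slit_plane
    by (intro holomorphic_intros) (auto simp: space_lborel01)
qed (use integrable_slit_kernel in auto)

text \<open>Insert the binomial series of the kernel and integrate term by term. For |z| < 1 the
  terms are bounded by the absolutely convergent binomial series in \<open>z\<close> times the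
  integrable function \<open>norm (g t)\<close>, since 0 < t < 1.\<close>

lemma has_fps_expansion_slit_kernel:
  "(\<lambda>z. \<integral>t. g t * (1 - z * of_real t) powr (- s) \<partial>lborel01) has_fps_expansion
     Abs_fps (\<lambda>n. pochhammer s n / fact n * (\<integral>t. g t * of_real t ^ n \<partial>lborel01))"
proof (rule has_fps_expansionI)
  have "eventually (\<lambda>z::complex. z \<in> ball 0 1) (nhds 0)"
    by (intro eventually_nhds_in_open) auto
  thus "\<forall>\<^sub>F z in nhds 0. (\<lambda>n. Abs_fps (\<lambda>n. pochhammer s n / fact n *
           (\<integral>t. g t * of_real t ^ n \<partial>lborel01)) $ n * z ^ n) sums
          (\<integral>t. g t * (1 - z * of_real t) powr (- s) \<partial>lborel01)"
  proof eventually_elim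
    case (elim z)
    have tz: "norm (z * of_real t) < 1" if "t \<in> {0<..<1}" for t
    proof -
      have "norm (z * of_real t) \<le> norm z * 1"
        unfolding norm_mult using that by (intro mult_left_mono) auto
      thus ?thesis using elim by auto
    qed
    define p where "p = (\<lambda>n t. pochhammer s n / fact n * z ^ n * (g t * of_real t ^ n))"
    have tn: "integrable lborel01 (\<lambda>t. g t * of_real t ^ n)" for n
      by (rule Bochner_Integration.integrable_bound[OF g])
         (use g in \<open>auto intro!: AE_I2 mult_left_le power_le_one borel_measurable_times
            borel_measurable_integrable[OF g] borel_measurable_lborel01I[of "\<lambda>t. of_real t ^ n"]
            continuous_intros simp: norm_mult norm_power space_lborel01\<close>)
    have p_int: "integrable lborel01 (p n)" for n
      unfolding p_def by (intro integrable_mult_right tn)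
    have p_le: "norm (p n t) \<le> norm (pochhammer s n / fact n * z ^ n) * norm (g t)"
      if "t \<in> {0<..<1}" for n t
      unfolding p_def norm_mult[of "pochhammer s n / fact n * z ^ n"]
      using that by (intro mult_left_mono) (auto simp: norm_mult norm_power intro!: mult_left_le power_le_one)
    have sum: "summable (\<lambda>n. norm (pochhammer s n / fact n * z ^ n))"
      using sums_one_minus_powr(2)[of z s] elim by simp
    have "(\<lambda>n. \<integral>t. p n t \<partial>lborel01) sums (\<integral>t. (\<Sum>n. p n t) \<partial>lborel01)"
    proof (rule sums_integral[OF p_int])
      show "AE t in lborel01. summable (\<lambda>n. norm (p n t))"
      proof (rule AE_I2)
        fix t assume "t \<in> space lborel01"
        thus "summable (\<lambda>n. norm (p n t))"
          using p_le by (intro summable_comparison_test'[OF summable_mult2[OF sum, of "norm (g t)"], of 0])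
            (auto simp: space_lborel01)
      qed
      show "summable (\<lambda>n. \<integral>t. norm (p n t) \<partial>lborel01)"
      proof (rule summable_comparison_test'[OF summable_mult2[OF sum], of 0])
        fix n
        have "(\<integral>t. norm (p n t) \<partial>lborel01) \<le>
              (\<integral>t. norm (pochhammer s n / fact n * z ^ n) * norm (g t) \<partial>lborel01)"
          using p_int g p_le by (intro integral_mono) (auto simp: space_lborel01)
        thus "norm (\<integral>t. norm (p n t) \<partial>lborel01) \<le>
              norm (pochhammer s n / fact n * z ^ n) * (\<integral>t. norm (g t) \<partial>lborel01)" by simp
      qed
    qed
    also have "(\<integral>t. (\<Sum>n. p n t) \<partial>lborel01) = (\<integral>t. g t * (1 - z * of_real t) powr (- s) \<partial>lborel01)"
    proof (rule Bochner_Integration.integral_cong[OF refl])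
      fix t assume t: "t \<in> space lborel01"
      have "(\<lambda>n. g t * (pochhammer s n / fact n * (z * of_real t) ^ n)) sums
              (g t * (1 - z * of_real t) powr (- s))"
        using t tz by (intro sums_mult sums_one_minus_powr) (auto simp: space_lborel01)
      also have "(\<lambda>n. g t * (pochhammer s n / fact n * (z * of_real t) ^ n)) = (\<lambda>n. p n t)"
        by (auto simp: p_def power_mult_distrib mult_ac)
      finally show "(\<Sum>n. p n t) = g t * (1 - z * of_real t) powr (- s)" by (simp add: sums_iff)
    qed
    also have "(\<lambda>n. \<integral>t. p n t \<partial>lborel01) = (\<lambda>n. Abs_fps (\<lambda>n. pochhammer s n / fact n *
           (\<integral>t. g t * of_real t ^ n \<partial>lborel01)) $ n * z ^ n)"
      unfolding p_def integral_mult_right_zero by (simp add: mult_ac)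
    finally show ?case .
  qed
qed

end

section \<open>The complex Beta integral\<close>

text \<open>The positive reals accumulate at 1 inside the half-plane, so the identity theorem
  applies. It serves to pass from real to complex parameters in the Beta integral.\<close>

lemma holomorphic_right_half_plane_eqI:
  fixes f g :: "complex \<Rightarrow> complex"
  assumes f: "f holomorphic_on {z. Re z > 0}" and g: "g holomorphic_on {z. Re z > 0}"
    and eq: "\<And>x. x > 0 \<Longrightarrow> f (of_real x) = g (of_real x)" and z: "Re z > 0"
  shows "f z = g z"
proof -
  have "(\<lambda>z. f z - g z) z = 0"
  proof (rule analytic_continuation[where f = "\<lambda>z. f z - g z" and S = "{z. Re z > 0}"
          and U = "of_real ` {0<..}" and \<xi> = 1])
    show "(\<lambda>z. f z - g z) holomorphic_on {z. Re z > 0}"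
      using f g by (intro holomorphic_intros)
    show "open {z. Re z > 0}" by (rule open_halfspace_Re_gt)
    show "connected {z. Re z > 0}" by (intro convex_connected convex_halfspace_Re_gt)
    show "(1 :: complex) islimpt of_real ` {0<..}"
    proof (rule islimptI)
      fix T :: "complex set" assume T: "1 \<in> T" "open T"
      then obtain e where e: "e > 0" "ball 1 e \<subseteq> T" using open_contains_ball by blast
      have "complex_of_real (1 + e/2) \<in> T" using e by (intro set_mp[OF e(2)]) (simp add: dist_norm)
      thus "\<exists>y\<in>of_real ` {0<..}. y \<in> T \<and> y \<noteq> 1" using e(1)
        by (intro bexI[of _ "complex_of_real (1 + e/2)"]) (auto simp del: of_real_add)
    qed
  qed (use eq z in auto)
  thus ?thesis by simp
qed

lemma has_bochner_integral_lborel01_iff: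
  fixes f :: "real \<Rightarrow> 'a :: {banach, second_countable_topology}"
  shows "has_bochner_integral lborel01 f I \<longleftrightarrow>
     set_integrable lborel {0<..<1} f \<and> set_lebesgue_integral lborel {0<..<1} f = I"
  by (simp add: has_bochner_integral_iff integrable_restrict_space integral_restrict_space
      set_integrable_def set_lebesgue_integral_def)

lemma has_bochner_integral_Beta_real:
  fixes x y :: real
  assumes "x > 0" "y > 0"
  shows "has_bochner_integral lborel01 (\<lambda>t. t powr (x - 1) * (1 - t) powr (y - 1)) (Beta x y)"
proof -
  have *: "set_integrable lborel {0<..<1} (\<lambda>t. t powr (x - 1) * (1 - t) powr (y - 1))"
    by (rule set_integrable_subset[OF integrable_Beta[OF assms]]) auto
  have "((\<lambda>t. t powr (x - 1) * (1 - t) powr (y - 1)) has_integral Beta x y) {0<..<1}"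
    using has_integral_Beta_real[OF assms] by (simp add: has_integral_Icc_iff_Ioo)
  with set_borel_integral_eq_integral(2)[OF *] * show ?thesis
    by (simp add: has_bochner_integral_lborel01_iff integral_unique)
qed

lemma norm_Beta_integrand:
  fixes z w :: complex
  assumes "t \<in> {0<..<1}"
  shows "norm (of_real t powr (z - 1) * of_real (1 - t) powr (w - 1)) =
           t powr (Re z - 1) * (1 - t) powr (Re w - 1)"
proof -
  have "norm (of_real t powr (z - 1)) = t powr (Re z - 1)"
    "norm (of_real (1 - t) powr (w - 1)) = (1 - t) powr (Re w - 1)"
    using assms by (subst norm_powr_real_powr; simp)+
  thus ?thesis by (simp only: norm_mult)
qed

lemma measurable_Beta_integrand:
  "(\<lambda>t. of_real t powr (z - 1) * of_real (1 - t) powr (w - 1) :: complex) \<in> borel_measurable lborel01"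
  by (intro borel_measurable_lborel01I continuous_intros continuous_on_powr_complex_slit)
     (auto simp: complex_nonpos_Reals_iff)

lemma integrable_Beta_complex:
  fixes z w :: complex
  assumes "Re z > 0" "Re w > 0"
  shows "integrable lborel01 (\<lambda>t. of_real t powr (z - 1) * of_real (1 - t) powr (w - 1) :: complex)"
proof (rule Bochner_Integration.integrable_bound[OF _ measurable_Beta_integrand])
  show "integrable lborel01 (\<lambda>t. t powr (Re z - 1) * (1 - t) powr (Re w - 1))"
    using has_bochner_integral_Beta_real[OF assms] by (simp add: has_bochner_integral_iff)
  show "AE t in lborel01. norm (of_real t powr (z - 1) * of_real (1 - t) powr (w - 1) :: complex)
          \<le> norm (t powr (Re z - 1) * (1 - t) powr (Re w - 1))"
    by (intro AE_I2) (subst norm_Beta_integrand, auto simp: space_lborel01)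
qed

lemma holomorphic_Beta_integral:
  assumes w: "Re w > 0"
  shows "(\<lambda>z. \<integral>t. of_real t powr (z - 1) * of_real (1 - t) powr (w - 1) \<partial>lborel01)
           holomorphic_on {z. Re z > 0}"
proof (rule holomorphic_on_lebesgue_integral)
  fix z :: complex assume "z \<in> {z. Re z > 0}"
  hence z: "Re z > 0" by simp
  show "\<exists>r>0. \<exists>g. integrable lborel01 g \<and> (\<forall>v\<in>{z. Re z > 0} \<inter> cball z r. \<forall>t\<in>space lborel01.
          norm (of_real t powr (v - 1) * of_real (1 - t) powr (w - 1) :: complex) \<le> g t)"
  \<comment> \<open>On the disc of radius \<open>Re z / 2\<close> every \<open>v\<close> has real
    part at least \<open>Re z / 2\<close>. As t < 1, the smaller exponent gives the larger power, so
    the real Beta integrand at \<open>Re z / 2\<close> is a majorant.\<close>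
  proof (intro exI[of _ "Re z / 2"] exI[of _ "\<lambda>t. t powr (Re z / 2 - 1) * (1 - t) powr (Re w - 1)"] conjI ballI)
    show "integrable lborel01 (\<lambda>t. t powr (Re z / 2 - 1) * (1 - t) powr (Re w - 1))"
      using has_bochner_integral_Beta_real[of "Re z / 2" "Re w"] z w by (simp add: has_bochner_integral_iff)
    fix v t assume v: "v \<in> {z. Re z > 0} \<inter> cball z (Re z / 2)" and t: "t \<in> space lborel01"
    have "\<bar>Re (z - v)\<bar> \<le> Re z / 2"
      using v abs_Re_le_cmod[of "z - v"] by (auto simp: dist_norm)
    hence "Re v \<ge> Re z / 2" by (simp add: abs_if split: if_splits)
    thus "norm (of_real t powr (v - 1) * of_real (1 - t) powr (w - 1) :: complex)
            \<le> t powr (Re z / 2 - 1) * (1 - t) powr (Re w - 1)"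
      using t by (subst norm_Beta_integrand) (auto simp: space_lborel01 intro!: mult_right_mono powr_mono')
  qed (use z in auto)
next
  fix t assume "t \<in> space lborel01"
  thus "(\<lambda>z. of_real t powr (z - 1) * of_real (1 - t) powr (w - 1) :: complex) holomorphic_on {z. Re z > 0}"
    by (intro holomorphic_intros) (auto simp: space_lborel01)
qed (use measurable_Beta_integrand open_halfspace_Re_gt in auto)

lemma has_bochner_integral_lborel01_reflect:
  fixes f :: "real \<Rightarrow> 'a :: {banach, second_countable_topology}"
  assumes "has_bochner_integral lborel01 f I"
  shows "has_bochner_integral lborel01 (\<lambda>t. f (1 - t)) I"
proof -
  define g where "g = (\<lambda>t. indicator {0<..<1::real} t *\<^sub>R f t)"
  have g: "integrable lborel g" "(\<integral>t. g t \<partial>lborel) = I"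
    using assms by (auto simp: has_bochner_integral_lborel01_iff set_integrable_def set_lebesgue_integral_def g_def)
  have "(\<integral>t. g t \<partial>lborel) = (\<integral>t. g (1 - t) \<partial>lborel)"
    using lborel_integral_real_affine[of "-1" g 1] by simp
  moreover have "integrable lborel (\<lambda>t. g (1 - t))"
    using lborel_integrable_real_affine[OF g(1), of "-1" 1] by simp
  moreover have "(\<lambda>t. g (1 - t)) = (\<lambda>t. indicator {0<..<1::real} t *\<^sub>R f (1 - t))"
    by (auto simp: g_def fun_eq_iff indicator_def)
  ultimately show ?thesis
    using g(2) by (simp add: has_bochner_integral_lborel01_iff set_integrable_def set_lebesgue_integral_def)
qed

text \<open>Reflection t -> 1 - t. It transfers the holomorphy already known in the first parameter
  to the second one.\<close>

lemma Beta_integral_commute: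
  fixes z w :: complex
  assumes "Re z > 0" "Re w > 0"
  shows "(\<integral>t. of_real t powr (z - 1) * of_real (1 - t) powr (w - 1) \<partial>lborel01) =
         (\<integral>t. of_real t powr (w - 1) * of_real (1 - t) powr (z - 1) \<partial>lborel01)"
  using has_bochner_integral_lborel01_reflect[OF has_bochner_integral_integrable[OF integrable_Beta_complex[OF assms(2,1)]]]
  by (simp add: has_bochner_integral_iff mult.commute)

text \<open>Continuation one variable at a time: the real Beta integral gives both parameters real
  (\<open>real\<close>), continuation in the first makes it complex (\<open>half\<close>), and
  continuation in the second finishes.\<close>

theorem has_bochner_integral_Beta_complex:
  fixes z w :: complex
  assumes z: "Re z > 0" and w: "Re w > 0"
  shows "has_bochner_integral lborel01 (\<lambda>t. of_real t powr (z - 1) * of_real (1 - t) powr (w - 1)) (Beta z w)"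
proof -
  define I where "I = (\<lambda>z w :: complex. \<integral>t. of_real t powr (z - 1) * of_real (1 - t) powr (w - 1) \<partial>lborel01)"
  have not_nonpos: "v \<notin> \<int>\<^sub>\<le>\<^sub>0" if "Re v > 0" for v :: complex
    using that by (auto elim!: nonpos_Ints_cases)
  have real: "I (of_real x) (of_real y) = Beta (of_real x) (of_real y)" if "x > 0" "y > 0" for x y
  proof -
    have "I (of_real x) (of_real y) =
            (\<integral>t. complex_of_real (t powr (x - 1) * (1 - t) powr (y - 1)) \<partial>lborel01)"
      unfolding I_def
      by (intro Bochner_Integration.integral_cong) (auto simp: space_lborel01 simp flip: powr_of_real)
    also have "\<dots> = of_real (Beta x y)"
      using has_bochner_integral_Beta_real[OF that]
      by (subst integral_complex_of_real) (simp add: has_bochner_integral_iff)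
    finally show ?thesis by (simp add: Beta_complex_of_real)
  qed
  have half: "I z (of_real y) = Beta z (of_real y)" if "Re z > 0" "y > 0" for z y
  proof (rule holomorphic_right_half_plane_eqI[of "\<lambda>z. I z (of_real y)" "\<lambda>z. Beta z (of_real y)"])
    show "(\<lambda>z. I z (of_real y)) holomorphic_on {z. Re z > 0}"
      unfolding I_def by (rule holomorphic_Beta_integral) (use that in simp)
  qed (use that real not_nonpos in \<open>auto intro!: holomorphic_intros\<close>)
  have "I z w = Beta z w"
  proof (rule holomorphic_right_half_plane_eqI[of "I z" "Beta z"])
    have "(\<lambda>w. I w z) holomorphic_on {z. Re z > 0}"
      unfolding I_def by (rule holomorphic_Beta_integral) fact
    thus "I z holomorphic_on {z. Re z > 0}"
      by (rule holomorphic_transform) (use z Beta_integral_commute in \<open>simp add: I_def\<close>)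
  qed (use z w half not_nonpos in \<open>auto intro!: holomorphic_intros\<close>)
  thus ?thesis using integrable_Beta_complex[OF z w] by (simp add: I_def has_bochner_integral_iff)
qed

section \<open>Gauss' summation theorem\<close>

lemma Re_pos_imp_not_nonpos_Int: "Re z > 0 \<Longrightarrow> z \<notin> \<int>\<^sub>\<le>\<^sub>0"
  by (auto elim!: nonpos_Ints_cases)

lemma not_nonpos_Int_add_of_nat:
  "z \<notin> \<int>\<^sub>\<le>\<^sub>0 \<Longrightarrow> z + of_nat n \<notin> \<int>\<^sub>\<le>\<^sub>0" for z :: "'a :: ring_char_0"
  by (induction n) (auto simp: add.assoc[symmetric] add.commute[of 1] dest: plus_one_in_nonpos_Ints_imp)

text \<open>The Taylor coefficients of F(a,b;c;z) at 0, which are at the same time the terms of the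
  series F(a,b;c;1).\<close>

definition hyp_coeff :: "complex \<Rightarrow> complex \<Rightarrow> complex \<Rightarrow> nat \<Rightarrow> complex" where
  "hyp_coeff a b c n = pochhammer a n * pochhammer b n / (pochhammer c n * fact n)"

lemma pochhammer_Suc_eq_rGamma_series:
  "n > 0 \<Longrightarrow> pochhammer z (Suc n) = rGamma_series z n * (fact n * exp (z * of_real (ln (of_nat n))))"
  for z :: complex
  by (simp add: rGamma_series_def)

text \<open>\<open>rGamma_series\<close> is Gauss' product for 1/Gamma. The quotient of two such
  convergent sequences is bounded because 1/Gamma(c) is nonzero; the power of n split off in the
  product is what remains. The index is \<open>Suc n\<close> because the n-th product contains n + 1
  linear factors.\<close>

lemma pochhammer_ratio_bound:
  fixes a c :: complex
  assumes c: "c \<notin> \<int>\<^sub>\<le>\<^sub>0"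
  obtains C where "\<And>n. n > 0 \<Longrightarrow>
    norm (pochhammer a (Suc n) / pochhammer c (Suc n)) \<le> C * real n powr Re (a - c)"
proof -
  have "(\<lambda>n. rGamma_series a n / rGamma_series c n) \<longlonglongrightarrow> rGamma a / rGamma c"
    using c by (intro tendsto_intros) (simp add: rGamma_eq_zero_iff)
  hence "Bseq (\<lambda>n. rGamma_series a n / rGamma_series c n)"
    by (rule convergent_imp_Bseq[OF convergentI])
  then obtain C where C: "\<And>n. norm (rGamma_series a n / rGamma_series c n) \<le> C"
    by (auto simp: Bseq_def)
  show ?thesis
  proof (rule that[of C])
    fix n :: nat assume n: "n > 0"
    have "pochhammer a (Suc n) / pochhammer c (Suc n) =
            rGamma_series a n / rGamma_series c n * exp ((a - c) * of_real (ln (of_nat n)))"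
      using n by (simp add: pochhammer_Suc_eq_rGamma_series algebra_simps exp_diff)
    also have "norm \<dots> = norm (rGamma_series a n / rGamma_series c n) * real n powr Re (a - c)"
      using n unfolding norm_mult by (simp add: powr_def)
    also have "\<dots> \<le> C * real n powr Re (a - c)" by (intro mult_right_mono C) auto
    finally show "norm (pochhammer a (Suc n) / pochhammer c (Suc n)) \<le> C * real n powr Re (a - c)" .
  qed
qed

text \<open>Writing n! as (1)_n makes the coefficient a product of two Pochhammer ratios, of order
  n^Re(a-c) and n^Re(b-1).\<close>

lemma hyp_coeff_bound:
  assumes c: "c \<notin> \<int>\<^sub>\<le>\<^sub>0"
  obtains C where "\<And>n. n > 0 \<Longrightarrow> norm (hyp_coeff a b c (Suc n)) \<le> C * real n powr (Re (a + b - c) - 1)"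
proof -
  obtain A where A: "\<And>n. n > 0 \<Longrightarrow>
    norm (pochhammer a (Suc n) / pochhammer c (Suc n)) \<le> A * real n powr Re (a - c)"
    using pochhammer_ratio_bound[OF c] by blast
  obtain B where B: "\<And>n. n > 0 \<Longrightarrow>
    norm (pochhammer b (Suc n) / pochhammer 1 (Suc n)) \<le> B * real n powr Re (b - 1)"
    using pochhammer_ratio_bound[of 1] by (auto simp: Re_pos_imp_not_nonpos_Int)
  show ?thesis
  proof (rule that[of "A * B"])
    fix n :: nat assume n: "n > 0"
    have "norm (hyp_coeff a b c (Suc n)) = norm (pochhammer a (Suc n) / pochhammer c (Suc n)) *
            norm (pochhammer b (Suc n) / pochhammer 1 (Suc n))"
      by (simp only: hyp_coeff_def pochhammer_fact norm_mult norm_divide times_divide_times_eq)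
    also have "\<dots> \<le> (A * real n powr Re (a - c)) * (B * real n powr Re (b - 1))"
      using n by (intro mult_mono A B order_trans[OF norm_ge_zero A]) auto
    also have "\<dots> = A * B * real n powr (Re (a + b - c) - 1)"
      using n by (simp add: powr_add[symmetric] algebra_simps)
    finally show "norm (hyp_coeff a b c (Suc n)) \<le> A * B * real n powr (Re (a + b - c) - 1)" .
  qed
qed

lemma summable_norm_powr_boundI:
  fixes f :: "nat \<Rightarrow> 'a :: real_normed_vector"
  assumes "\<And>n. n > 0 \<Longrightarrow> norm (f (Suc n)) \<le> C * real n powr p" "p < -1"
  shows "summable (\<lambda>n. norm (f n))"
proof -
  have "summable (\<lambda>n. C * real n powr p)"
    using assms(2) by (intro summable_mult) (simp add: summable_real_powr_iff)
  hence "summable (\<lambda>n. norm (f (Suc n)))"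
    by (rule summable_comparison_test'[of _ 1]) (use assms(1) in auto)
  thus ?thesis using summable_Suc_iff[of "\<lambda>n. norm (f n)"] by blast
qed

lemma summable_norm_hyp_coeff:
  assumes "c \<notin> \<int>\<^sub>\<le>\<^sub>0" "Re (c - a - b) > 0"
  shows "summable (\<lambda>n. norm (hyp_coeff a b c n))"
proof -
  obtain C where C: "\<And>n. n > 0 \<Longrightarrow> norm (hyp_coeff a b c (Suc n)) \<le> C * real n powr (Re (a + b - c) - 1)"
    using hyp_coeff_bound[OF assms(1)] by blast
  show ?thesis by (rule summable_norm_powr_boundI[OF C]) (use assms in auto)
qed

text \<open>This product is the boundary term of the telescoping sum behind the recurrence in c; its
  order is n to the power -Re(c-a-b).\<close>

lemma of_nat_mult_hyp_coeff_tendsto_0: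
  assumes c: "c \<notin> \<int>\<^sub>\<le>\<^sub>0" and abc: "Re (c - a - b) > 0"
  shows "(\<lambda>n. of_nat n * hyp_coeff a b c n) \<longlonglongrightarrow> 0"
proof (rule LIMSEQ_imp_Suc)
  obtain C where C: "\<And>n. n > 0 \<Longrightarrow> norm (hyp_coeff a b c (Suc n)) \<le> C * real n powr (Re (a + b - c) - 1)"
    using hyp_coeff_bound[OF c] by blast
  have lim: "(\<lambda>n. 2 * (C * real n powr - Re (c - a - b))) \<longlonglongrightarrow> 2 * (C * 0)"
    by (intro tendsto_intros tendsto_neg_powr filterlim_real_sequentially) (use abc in simp)
  show "(\<lambda>n. of_nat (Suc n) * hyp_coeff a b c (Suc n)) \<longlonglongrightarrow> 0"
  proof (rule Lim_null_comparison)
    show "\<forall>\<^sub>F n in sequentially. norm (of_nat (Suc n) * hyp_coeff a b c (Suc n)) \<le>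
            2 * (C * real n powr - Re (c - a - b))"
      using eventually_gt_at_top[of 0]
    proof eventually_elim
      case (elim n)
      have "norm (of_nat (Suc n) * hyp_coeff a b c (Suc n)) = real (Suc n) * norm (hyp_coeff a b c (Suc n))"
        by (simp only: norm_mult norm_of_nat)
      also have "\<dots> \<le> (2 * real n) * (C * real n powr (Re (a + b - c) - 1))"
        using elim by (intro mult_mono C) auto
      also have "\<dots> = 2 * (C * real n powr - Re (c - a - b))"
        using elim powr_add[of "real n" 1 "Re (a + b - c) - 1"] by (simp add: algebra_simps)
      finally show ?case .
    qed
  qed (use lim in simp)
qed

lemma pochhammer_nonzero: "c \<notin> \<int>\<^sub>\<le>\<^sub>0 \<Longrightarrow> pochhammer c n \<noteq> (0 :: complex)"
  using pochhammer_eq_0_imp_nonpos_Int by blast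

lemma add_of_nat_nonzero: "c \<notin> \<int>\<^sub>\<le>\<^sub>0 \<Longrightarrow> c + of_nat n \<noteq> (0 :: complex)"
  by (metis add_eq_0_iff2 minus_of_nat_in_nonpos_Ints)

lemma hyp_coeff_0: "hyp_coeff a b c 0 = 1"
  by (simp add: hyp_coeff_def)

lemma hyp_coeff_Suc:
  "hyp_coeff a b c (Suc n) = hyp_coeff a b c n * ((a + of_nat n) * (b + of_nat n) / ((c + of_nat n) * of_nat (Suc n)))"
  by (simp add: hyp_coeff_def pochhammer_Suc mult_ac)

lemma hyp_coeff_shift:
  assumes "c \<notin> \<int>\<^sub>\<le>\<^sub>0"
  shows "hyp_coeff a b (c + 1) n = hyp_coeff a b c n * (c / (c + of_nat n))"
proof -
  have c: "c \<noteq> 0" using assms by auto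
  have "c * pochhammer (c + 1) n = pochhammer c n * (c + of_nat n)"
    using pochhammer_rec[of c n] pochhammer_Suc[of c n] by simp
  hence "pochhammer (c + 1) n = pochhammer c n * (c + of_nat n) / c"
    using c by (simp add: field_simps)
  thus ?thesis using c by (simp add: hyp_coeff_def)
qed

lemma suminf_hyp_coeff_shift:
  assumes c: "c \<notin> \<int>\<^sub>\<le>\<^sub>0" and abc: "Re (c - a - b) > 0"
  shows "c * (c - a - b) * suminf (hyp_coeff a b c) = (c - a) * (c - b) * suminf (hyp_coeff a b (c + 1))"
proof -
  have c1: "c + 1 \<notin> \<int>\<^sub>\<le>\<^sub>0" using c plus_one_in_nonpos_Ints_imp by blast
  have sums: "(\<lambda>n. hyp_coeff a b c n) sums suminf (hyp_coeff a b c)"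
    "(\<lambda>n. hyp_coeff a b (c + 1) n) sums suminf (hyp_coeff a b (c + 1))"
    using summable_norm_hyp_coeff[of c a b] summable_norm_hyp_coeff[of "c + 1" a b] c c1 abc
    by (auto intro!: summable_sums summable_norm_cancel)
  \<comment> \<open>the difference of the two series telescopes with partial sums \<open>T\<close>\<close>
  define T where "T = (\<lambda>n. - c * (of_nat n * hyp_coeff a b c n))"
  have "T \<longlonglongrightarrow> - c * 0"
    unfolding T_def by (intro tendsto_intros of_nat_mult_hyp_coeff_tendsto_0 c abc)
  hence "(\<lambda>n. T (Suc n) - T n) sums (- c * 0 - T 0)" by (rule telescope_sums)
  moreover have "T (Suc n) - T n = c * (c - a - b) * hyp_coeff a b c n -
                   (c - a) * (c - b) * hyp_coeff a b (c + 1) n" for n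
  proof -
    define u where "u = hyp_coeff a b c n"
    define N :: complex where "N = of_nat n"
    have nz: "c + N \<noteq> 0" "N + 1 \<noteq> 0"
      using add_of_nat_nonzero[OF c] by (auto simp: N_def add_eq_0_iff2)
         (metis of_nat_Suc of_nat_neq_0 add.commute neg_eq_iff_add_eq_0)
    have 1: "of_nat (Suc n) * hyp_coeff a b c (Suc n) = u * ((a + N) * (b + N) / (c + N))"
      unfolding hyp_coeff_Suc using nz by (simp add: u_def N_def add.commute)
    \<comment> \<open>With both neighbouring coefficients expressed through \<open>u\<close>, the
      telescoping claim is a rational identity whose only denominator is
      \<open>c + N\<close>.\<close>
    have "- c * (u * ((a + N) * (b + N) / (c + N))) + c * (N * u) =
            c * (c - a - b) * u - (c - a) * (c - b) * (u * (c / (c + N)))"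
      using nz by (simp add: divide_simps) algebra
    thus ?thesis unfolding T_def 1 hyp_coeff_shift[OF c] by (simp add: u_def N_def)
  qed
  ultimately have "(\<lambda>n. c * (c - a - b) * hyp_coeff a b c n -
                   (c - a) * (c - b) * hyp_coeff a b (c + 1) n) sums 0" by (simp add: T_def)
  moreover have "(\<lambda>n. c * (c - a - b) * hyp_coeff a b c n - (c - a) * (c - b) * hyp_coeff a b (c + 1) n) sums
     (c * (c - a - b) * suminf (hyp_coeff a b c) - (c - a) * (c - b) * suminf (hyp_coeff a b (c + 1)))"
    by (intro sums_diff sums_mult sums)
  ultimately show ?thesis using sums_unique2 by fastforce
qed

text \<open>Iterating the recurrence pushes c towards infinity. There the series tends to 1, while
  the accumulated Pochhammer quotient tends to a quotient of Gamma values; this is Gauss' own route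
  to the sum.\<close>

lemma suminf_hyp_coeff_shift_iterate:
  assumes c: "c \<notin> \<int>\<^sub>\<le>\<^sub>0" and abc: "Re (c - a - b) > 0"
  shows "suminf (hyp_coeff a b c) = pochhammer (c - a) n * pochhammer (c - b) n /
           (pochhammer c n * pochhammer (c - a - b) n) * suminf (hyp_coeff a b (c + of_nat n))"
proof (induction n)
  case (Suc n)
  have cn: "c + of_nat n \<notin> \<int>\<^sub>\<le>\<^sub>0" using c not_nonpos_Int_add_of_nat by blast
  have nz: "c + of_nat n \<noteq> 0" "c - a - b + of_nat n \<noteq> 0"
    using add_of_nat_nonzero[OF c] add_of_nat_nonzero[OF Re_pos_imp_not_nonpos_Int[OF abc]] by auto
  have "(c + of_nat n) * (c - a - b + of_nat n) * suminf (hyp_coeff a b (c + of_nat n)) =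
     (c - a + of_nat n) * (c - b + of_nat n) * suminf (hyp_coeff a b (c + of_nat (Suc n)))"
    using suminf_hyp_coeff_shift[OF cn, of a b] abc by (simp add: algebra_simps)
  hence "suminf (hyp_coeff a b (c + of_nat n)) = (c - a + of_nat n) * (c - b + of_nat n) /
     ((c + of_nat n) * (c - a - b + of_nat n)) * suminf (hyp_coeff a b (c + of_nat (Suc n)))"
    using nz by (simp add: nonzero_eq_divide_eq mult_ac)
  with Suc.IH show ?case by (simp add: pochhammer_Suc mult_ac)
qed auto

text \<open>Only the first factor is used to gain the ratio (Re c + x)/Re c; each later factor is
  bounded below by its value at \<open>Re c\<close>. The gain is the same for every
  \<open>n\<close>, which gives uniform control of the whole tail.\<close>

lemma norm_pochhammer_add_ge:
  assumes c: "Re c > 0" and x: "x \<ge> 0"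
  shows "norm (pochhammer (c + of_real x) (Suc n)) \<ge> (Re c + x) / Re c * pochhammer (Re c) (Suc n)"
proof (induction n)
  case 0
  have "Re (c + of_real x) \<le> norm (c + of_real x)" by (rule complex_Re_le_cmod)
  thus ?case using c by simp
next
  case (Suc n)
  have "Re (c + of_real x + of_nat (Suc n)) \<le> norm (c + of_real x + of_nat (Suc n))"
    by (rule complex_Re_le_cmod)
  hence 1: "Re c + of_nat (Suc n) \<le> norm (c + of_real x + of_nat (Suc n))" using x by simp
  have "(Re c + x) / Re c * pochhammer (Re c) (Suc (Suc n)) =
          (Re c + x) / Re c * pochhammer (Re c) (Suc n) * (Re c + of_nat (Suc n))"
    by (subst pochhammer_Suc) simp
  also have "\<dots> \<le> norm (pochhammer (c + of_real x) (Suc n)) * norm (c + of_real x + of_nat (Suc n))"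
    using c by (intro mult_mono Suc.IH 1) auto
  also have "\<dots> = norm (pochhammer (c + of_real x) (Suc (Suc n)))"
    by (subst (2) pochhammer_Suc) (simp only: norm_mult)
  finally show ?case .
qed

text \<open>Past its leading term 1, the shifted series is dominated by r/(r+m) times the fixed
  convergent series with lower parameter \<open>r = Re c\<close>, so the remainder is of order
  1/m.\<close>

lemma suminf_hyp_coeff_tendsto_1:
  assumes c: "Re c > 0" and abc: "Re (c - a - b) > 0"
  shows "(\<lambda>m. suminf (hyp_coeff a b (c + of_nat m))) \<longlonglongrightarrow> 1"
proof -
  define r where "r = Re c"
  define U where "U = (\<lambda>n. norm (hyp_coeff a b (of_real r) n))"
  have U: "summable U"
    unfolding U_def by (rule summable_norm_hyp_coeff) (use c abc in \<open>auto simp: r_def Re_pos_imp_not_nonpos_Int\<close>)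
  have le: "norm (hyp_coeff a b (c + of_nat m) (Suc n)) \<le> r / (r + real m) * U (Suc n)" for m n
  proof -
    have pos: "pochhammer r (Suc n) > 0" using c by (intro pochhammer_pos) (simp add: r_def)
    have "norm (hyp_coeff a b (c + of_nat m) (Suc n)) =
        norm (pochhammer a (Suc n) * pochhammer b (Suc n)) / (norm (pochhammer (c + of_real m) (Suc n)) * fact (Suc n))"
      by (simp add: hyp_coeff_def norm_divide norm_mult del: fact_Suc)
    also have "\<dots> \<le> norm (pochhammer a (Suc n) * pochhammer b (Suc n)) /
                  ((r + real m) / r * pochhammer r (Suc n) * fact (Suc n))"
    proof (intro divide_left_mono mult_right_mono mult_pos_pos)
      show ge: "(r + real m) / r * pochhammer r (Suc n) \<le> norm (pochhammer (c + of_real m) (Suc n))"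
        unfolding r_def by (rule norm_pochhammer_add_ge) (use c in auto)
      show gt: "0 < (r + real m) / r" using c by (auto simp: r_def intro!: divide_pos_pos)
      show "0 < norm (pochhammer (c + of_real m) (Suc n))"
        using mult_pos_pos[OF gt pos] ge by linarith
    qed (use pos in auto)
    also have "\<dots> = r / (r + real m) * U (Suc n)"
      using pos by (simp add: U_def hyp_coeff_def norm_divide norm_mult pochhammer_of_real mult_ac del: fact_Suc)
    finally show ?thesis .
  qed
  have US: "summable (\<lambda>n. U (Suc n))" using U by (simp only: summable_Suc_iff)
  have bound: "norm (suminf (hyp_coeff a b (c + of_nat m)) - 1) \<le> r / (r + real m) * (\<Sum>n. U (Suc n))" for m
  proof -
    have s: "summable (\<lambda>n. norm (hyp_coeff a b (c + of_nat m) n))"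
      by (rule summable_norm_hyp_coeff) (use c abc in \<open>auto simp: Re_pos_imp_not_nonpos_Int\<close>)
    have sS: "summable (\<lambda>n. norm (hyp_coeff a b (c + of_nat m) (Suc n)))"
      using s summable_Suc_iff[of "\<lambda>n. norm (hyp_coeff a b (c + of_nat m) n)"] by blast
    have "suminf (hyp_coeff a b (c + of_nat m)) - 1 = (\<Sum>n. hyp_coeff a b (c + of_nat m) (Suc n))"
      using suminf_split_head[OF summable_norm_cancel[OF s]] by (simp add: hyp_coeff_0)
    also have "norm \<dots> \<le> (\<Sum>n. norm (hyp_coeff a b (c + of_nat m) (Suc n)))"
      by (rule summable_norm[OF sS])
    also have "\<dots> \<le> (\<Sum>n. r / (r + real m) * U (Suc n))"
      by (intro suminf_le le summable_mult US sS)
    also have "\<dots> = r / (r + real m) * (\<Sum>n. U (Suc n))" by (rule suminf_mult[OF US])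
    finally show ?thesis .
  qed
  have "(\<lambda>m. r / (r + real m) * (\<Sum>n. U (Suc n))) \<longlonglongrightarrow> 0 * (\<Sum>n. U (Suc n))"
    by (intro tendsto_mult tendsto_const real_tendsto_divide_at_top[OF tendsto_const]
          filterlim_tendsto_add_at_top[OF tendsto_const] filterlim_real_sequentially)
  hence lim: "(\<lambda>m. r / (r + real m) * (\<Sum>n. U (Suc n))) \<longlonglongrightarrow> 0" by simp
  have "(\<lambda>m. suminf (hyp_coeff a b (c + of_nat m)) - 1) \<longlonglongrightarrow> 0"
    by (rule Lim_null_comparison[OF always_eventually[OF allI[OF bound]] lim])
  thus ?thesis by (simp add: LIM_zero_iff)
qed

theorem Gauss_hypergeometric_sum:
  assumes c: "Re c > 0" and abc: "Re (c - a - b) > 0"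
  shows "hyp_coeff a b c sums (Gamma c * Gamma (c - a - b) * rGamma (c - a) * rGamma (c - b))"
proof -
  have nz: "c \<notin> \<int>\<^sub>\<le>\<^sub>0" "c - a - b \<notin> \<int>\<^sub>\<le>\<^sub>0" using c abc Re_pos_imp_not_nonpos_Int by auto
  define P where "P = (\<lambda>n. pochhammer (c - a) n * pochhammer (c - b) n /
           (pochhammer c n * pochhammer (c - a - b) n))"
  have "(\<lambda>n. rGamma_series (c - a) n * rGamma_series (c - b) n /
           (rGamma_series c n * rGamma_series (c - a - b) n)) \<longlonglongrightarrow>
         rGamma (c - a) * rGamma (c - b) / (rGamma c * rGamma (c - a - b))"
    using nz by (intro tendsto_intros) (auto simp: rGamma_eq_zero_iff)
  moreover have "eventually (\<lambda>n. rGamma_series (c - a) n * rGamma_series (c - b) n /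
           (rGamma_series c n * rGamma_series (c - a - b) n) = P (Suc n)) sequentially"
    using eventually_gt_at_top[of 0]
  proof eventually_elim
    case (elim n)
    define L where "L = complex_of_real (ln (of_nat n))"
    \<comment> \<open>The powers of n in the four Gauss products cancel because (c-a) + (c-b) = c +
      (c-a-b).\<close>
    have "exp ((c - a) * L) * exp ((c - b) * L) = exp (c * L) * exp ((c - a - b) * L)"
      by (simp add: algebra_simps flip: exp_add)
    thus ?case using elim unfolding P_def
      by (simp add: pochhammer_Suc_eq_rGamma_series field_simps flip: L_def)
  qed
  ultimately have "(\<lambda>n. P (Suc n)) \<longlonglongrightarrow> rGamma (c - a) * rGamma (c - b) / (rGamma c * rGamma (c - a - b))"
    by (rule Lim_transform_eventually)
  hence "P \<longlonglongrightarrow> rGamma (c - a) * rGamma (c - b) / (rGamma c * rGamma (c - a - b))"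
    by (rule LIMSEQ_imp_Suc)
  hence "(\<lambda>n. P n * suminf (hyp_coeff a b (c + of_nat n))) \<longlonglongrightarrow>
      rGamma (c - a) * rGamma (c - b) / (rGamma c * rGamma (c - a - b)) * 1"
    by (intro tendsto_mult suminf_hyp_coeff_tendsto_1 c abc)
  \<comment> \<open>By the iterated recurrence the sequence is constant, equal to the desired sum,
    so its limit is its value.\<close>
  hence "suminf (hyp_coeff a b c) = rGamma (c - a) * rGamma (c - b) / (rGamma c * rGamma (c - a - b)) * 1"
    unfolding P_def suminf_hyp_coeff_shift_iterate[OF nz(1) abc, symmetric] by (simp add: LIMSEQ_const_iff)
  also have "\<dots> = Gamma c * Gamma (c - a - b) * rGamma (c - a) * rGamma (c - b)"
    by (simp add: Gamma_def field_simps)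
  finally show ?thesis
    using summable_norm_cancel[OF summable_norm_hyp_coeff[OF nz(1) abc]] by (simp add: sums_iff)
qed

lemma Beta_add_of_nat:
  fixes x y :: "'a :: Gamma"
  assumes "x \<notin> \<int>\<^sub>\<le>\<^sub>0" "x + y \<notin> \<int>\<^sub>\<le>\<^sub>0"
  shows "Beta (x + of_nat n) y = Beta x y * (pochhammer x n / pochhammer (x + y) n)"
proof -
  have "x + y + of_nat n \<notin> \<int>\<^sub>\<le>\<^sub>0" using assms(2) not_nonpos_Int_add_of_nat by blast
  moreover have "pochhammer x n \<noteq> 0" "pochhammer (x + y) n \<noteq> 0"
    using assms pochhammer_eq_0_imp_nonpos_Int by blast+
  moreover have "Gamma x \<noteq> 0" "Gamma (x + y) \<noteq> 0" using assms by (auto simp: Gamma_eq_zero_iff)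
  ultimately show ?thesis
    using pochhammer_Gamma[OF assms(1), of n] pochhammer_Gamma[OF assms(2), of n]
    by (simp add: Beta_def Gamma_eq_zero_iff field_simps add_ac)
qed

section \<open>Analytic continuation and Pfaff's transformation\<close>

text \<open>Prescribing the Taylor series at 0 instead of the values on the unit disc lets
  continuations be built by formal power series algebra.\<close>

definition hyp_continuation :: "complex \<Rightarrow> complex \<Rightarrow> complex \<Rightarrow> (complex \<Rightarrow> complex) \<Rightarrow> bool" where
  "hyp_continuation a b c f \<longleftrightarrow>
     f holomorphic_on slit_plane \<and> f has_fps_expansion Abs_fps (hyp_coeff a b c)"

lemma fps_hypergeo_2_1_eq: "fps_hypergeo [a, b] [c] 1 = Abs_fps (hyp_coeff a b c)"
  by (simp add: fps_eq_iff hyp_coeff_def)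

text \<open>Euler's integral: the moments of the Beta density with parameters b and c - b are
  multiples of (b)_n/(c)_n, and the kernel with exponent \<open>- a\<close> contributes (a)_n/n!.
  The two inequalities are the convergence conditions at the endpoints.\<close>

lemma hyp_continuation_Euler_integral:
  assumes b: "Re b > 0" and cb: "Re (c - b) > 0"
  shows "\<exists>f. hyp_continuation a b c f"
proof -
  define g where "g = (\<lambda>t. of_real t powr (b - 1) * of_real (1 - t) powr ((c - b) - 1) :: complex)"
  have g: "integrable lborel01 g" unfolding g_def by (rule integrable_Beta_complex) fact+
  define f where "f = (\<lambda>z. inverse (Beta b (c - b)) * (\<integral>t. g t * (1 - z * of_real t) powr (- a) \<partial>lborel01))"
  have nz: "b \<notin> \<int>\<^sub>\<le>\<^sub>0" "c - b \<notin> \<int>\<^sub>\<le>\<^sub>0" "c \<notin> \<int>\<^sub>\<le>\<^sub>0" using b cb by (auto intro!: Re_pos_imp_not_nonpos_Int)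
  hence B: "Beta b (c - b) \<noteq> 0" by (simp add: Beta_def Gamma_eq_zero_iff)
  have moment: "(\<integral>t. g t * of_real t ^ n \<partial>lborel01) = Beta b (c - b) * (pochhammer b n / pochhammer c n)" for n
  proof -
    have "(\<integral>t. g t * of_real t ^ n \<partial>lborel01) =
            (\<integral>t. of_real t powr (b + of_nat n - 1) * of_real (1 - t) powr ((c - b) - 1) \<partial>lborel01)"
    proof (intro Bochner_Integration.integral_cong refl)
      fix t assume t: "t \<in> space lborel01"
      have "complex_of_real t powr (b + of_nat n - 1) = of_real t powr ((b - 1) + of_nat n)"
        by (simp add: algebra_simps)
      also have "\<dots> = of_real t powr (b - 1) * of_real t ^ n"
        using t by (subst powr_add) (simp add: powr_nat space_lborel01)
      finally show "g t * of_real t ^ n = of_real t powr (b + of_nat n - 1) * of_real (1 - t) powr ((c - b) - 1)"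
        by (simp add: g_def)
    qed
    also have "\<dots> = Beta (b + of_nat n) (c - b)"
      using has_bochner_integral_Beta_complex[of "b + of_nat n" "c - b"] b cb
      by (simp add: has_bochner_integral_iff)
    also have "\<dots> = Beta b (c - b) * (pochhammer b n / pochhammer c n)"
      using Beta_add_of_nat[of b "c - b" n] nz by simp
    finally show ?thesis .
  qed
  have "f holomorphic_on slit_plane"
    unfolding f_def by (intro holomorphic_intros holomorphic_slit_kernel g)
  moreover have "f has_fps_expansion fps_const (inverse (Beta b (c - b))) *
      Abs_fps (\<lambda>n. pochhammer a n / fact n * (\<integral>t. g t * of_real t ^ n \<partial>lborel01))"
    unfolding f_def by (intro has_fps_expansion_cmult_left has_fps_expansion_slit_kernel g)
  moreover have "fps_const (inverse (Beta b (c - b))) *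
      Abs_fps (\<lambda>n. pochhammer a n / fact n * (\<integral>t. g t * of_real t ^ n \<partial>lborel01)) = Abs_fps (hyp_coeff a b c)"
    unfolding moment using B by (simp add: fps_eq_iff hyp_coeff_def field_simps)
  ultimately show ?thesis by (auto simp: hyp_continuation_def)
qed

text \<open>The operator 1 + (z/c) d/dz multiplies the n-th coefficient by (c+n)/c, exactly the
  ratio between lower parameters c and c + 1.\<close>

lemma hyp_continuation_lower_c:
  assumes f: "hyp_continuation a b (c + 1) f" and c: "c \<notin> \<int>\<^sub>\<le>\<^sub>0"
  shows "hyp_continuation a b c (\<lambda>z. f z + (1 / c) * (z * deriv f z))"
proof -
  let ?F = "Abs_fps (hyp_coeff a b (c + 1))"
  have "(\<lambda>z. f z + (1 / c) * (z * deriv f z)) has_fps_expansion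
          ?F + fps_const (1 / c) * (fps_X * fps_deriv ?F)"
    using f unfolding hyp_continuation_def by (intro fps_expansion_intros) auto
  moreover have "?F + fps_const (1 / c) * (fps_X * fps_deriv ?F) = Abs_fps (hyp_coeff a b c)"
  proof (rule fps_ext)
    fix n
    have "(?F + fps_const (1 / c) * (fps_X * fps_deriv ?F)) $ n = hyp_coeff a b (c + 1) n * (1 + of_nat n / c)"
      by (cases n) (simp_all add: algebra_simps add_divide_distrib)
    also have "\<dots> = Abs_fps (hyp_coeff a b c) $ n"
      using c add_of_nat_nonzero[OF c, of n] unfolding hyp_coeff_shift[OF c] by (auto simp: field_simps)
    finally show "(?F + fps_const (1 / c) * (fps_X * fps_deriv ?F)) $ n = Abs_fps (hyp_coeff a b c) $ n" .
  qed
  ultimately show ?thesis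
    using f open_slit_plane by (auto simp: hyp_continuation_def intro!: holomorphic_intros)
qed

text \<open>Gauss' contiguous relation (c-b-1) F(b) + (2b+2-c + (a-b-1) z) F(b+1) + (b+1)(z-1)
  F(b+2) = 0, read off coefficient by coefficient; here F(b) stands for F(a,b;c;z).\<close>

lemma hyp_coeff_contiguous:
  assumes c: "c \<notin> \<int>\<^sub>\<le>\<^sub>0"
  shows "(c - b - 1) * hyp_coeff a b c 0 + (2 * b + 2 - c) * hyp_coeff a (b + 1) c 0
           - (b + 1) * hyp_coeff a (b + 2) c 0 = 0"
    and "(c - b - 1) * hyp_coeff a b c (Suc n) + (2 * b + 2 - c) * hyp_coeff a (b + 1) c (Suc n)
           + (a - b - 1) * hyp_coeff a (b + 1) c n + (b + 1) * hyp_coeff a (b + 2) c n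
           - (b + 1) * hyp_coeff a (b + 2) c (Suc n) = 0"
proof -
  show "(c - b - 1) * hyp_coeff a b c 0 + (2 * b + 2 - c) * hyp_coeff a (b + 1) c 0
           - (b + 1) * hyp_coeff a (b + 2) c 0 = 0" by (simp add: hyp_coeff_def)
  define m :: complex where "m = of_nat n"
  define Q where "Q = pochhammer (b + 1) n"
  \<comment> \<open>A common factor of all five terms; what remains are polynomials in a, b, c and
    m, so the relation becomes an algebraic identity.\<close>
  define D where "D = pochhammer a n * Q / (pochhammer c n * fact n * (c + m) * (m + 1))"
  have nz: "c + m \<noteq> 0" "m + 1 \<noteq> 0" "pochhammer c n \<noteq> 0"
    using add_of_nat_nonzero[OF c] pochhammer_nonzero[OF c] of_nat_neq_0[of n, where 'a = complex]
    by (auto simp: m_def add.commute)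
  have b0: "pochhammer b (Suc n) = b * Q" unfolding Q_def by (rule pochhammer_rec)
  have b1: "pochhammer (b + 1) (Suc n) = Q * (b + 1 + m)" by (simp add: Q_def m_def pochhammer_Suc)
  \<comment> \<open>The factor \<open>b + 1\<close> may vanish, so it stays attached to the
    Pochhammer symbols of \<open>b + 2\<close> and is never divided out.\<close>
  have b2: "(b + 1) * pochhammer (b + 2) n = Q * (b + 1 + m)"
    using pochhammer_rec[of "b + 1" n] b1 by (simp add: add.assoc)
  have b2': "(b + 1) * pochhammer (b + 2) (Suc n) = Q * (b + 1 + m) * (b + 2 + m)"
    unfolding pochhammer_Suc[of "b + 2"] mult.assoc[symmetric] b2 by (simp add: m_def)
  have "hyp_coeff a b c (Suc n) = D * (b * (a + m))"
    "hyp_coeff a (b + 1) c (Suc n) = D * ((b + 1 + m) * (a + m))"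
    "hyp_coeff a (b + 1) c n = D * ((c + m) * (m + 1))"
    "(b + 1) * hyp_coeff a (b + 2) c n = D * ((b + 1 + m) * (c + m) * (m + 1))"
    "(b + 1) * hyp_coeff a (b + 2) c (Suc n) = D * ((b + 1 + m) * (b + 2 + m) * (a + m))"
  proof -
    have fs: "fact (Suc n) = fact n * (m + 1)" by (simp add: m_def mult.commute)
    have as: "pochhammer a (Suc n) = pochhammer a n * (a + m)" "pochhammer c (Suc n) = pochhammer c n * (c + m)"
      by (simp_all add: m_def pochhammer_Suc)
    show "hyp_coeff a b c (Suc n) = D * (b * (a + m))"
      unfolding hyp_coeff_def D_def b0 as fs by (simp add: mult_ac)
    show "hyp_coeff a (b + 1) c (Suc n) = D * ((b + 1 + m) * (a + m))"
      unfolding hyp_coeff_def D_def b1 as fs by (simp add: mult_ac)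
    show "hyp_coeff a (b + 1) c n = D * ((c + m) * (m + 1))"
      unfolding hyp_coeff_def D_def Q_def[symmetric] using nz by simp
    have "(b + 1) * hyp_coeff a (b + 2) c n = pochhammer a n * ((b + 1) * pochhammer (b + 2) n) / (pochhammer c n * fact n)"
      unfolding hyp_coeff_def by simp
    also have "\<dots> = D * ((b + 1 + m) * (c + m) * (m + 1))" unfolding b2 D_def using nz by (simp add: mult_ac)
    finally show "(b + 1) * hyp_coeff a (b + 2) c n = D * ((b + 1 + m) * (c + m) * (m + 1))" .
    have "(b + 1) * hyp_coeff a (b + 2) c (Suc n) =
            pochhammer a (Suc n) * ((b + 1) * pochhammer (b + 2) (Suc n)) / (pochhammer c (Suc n) * fact (Suc n))"
      unfolding hyp_coeff_def by (simp del: fact_Suc)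
    also have "\<dots> = D * ((b + 1 + m) * (b + 2 + m) * (a + m))" unfolding b2' D_def as fs by (simp add: mult_ac)
    finally show "(b + 1) * hyp_coeff a (b + 2) c (Suc n) = D * ((b + 1 + m) * (b + 2 + m) * (a + m))" .
  qed
  note eqs = this
  show "(c - b - 1) * hyp_coeff a b c (Suc n) + (2 * b + 2 - c) * hyp_coeff a (b + 1) c (Suc n)
           + (a - b - 1) * hyp_coeff a (b + 1) c n + (b + 1) * hyp_coeff a (b + 2) c n
           - (b + 1) * hyp_coeff a (b + 2) c (Suc n) = 0"
    unfolding eqs by algebra
qed

text \<open>The contiguous relation is solved for F(b). The only division is by the constant c - b -
  1; the other coefficients are polynomials in z, so holomorphy on the slit plane survives.\<close>

lemma hyp_continuation_lower_b:
  assumes f: "hyp_continuation a (b + 1) c f" and g: "hyp_continuation a (b + 2) c g"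
    and c: "c \<notin> \<int>\<^sub>\<le>\<^sub>0" "c \<noteq> b + 1"
  shows "\<exists>h. hyp_continuation a b c h"
proof -
  let ?F = "Abs_fps (hyp_coeff a (b + 1) c)"
  let ?G = "Abs_fps (hyp_coeff a (b + 2) c)"
  define h where "h = (\<lambda>z. (- 1 / (c - b - 1)) * ((2 * b + 2 - c) * f z + (a - b - 1) * (z * f z)
                          + (b + 1) * (z * g z) - (b + 1) * g z))"
  have "h has_fps_expansion fps_const (- 1 / (c - b - 1)) * (fps_const (2 * b + 2 - c) * ?F +
          fps_const (a - b - 1) * (fps_X * ?F) + fps_const (b + 1) * (fps_X * ?G) - fps_const (b + 1) * ?G)"
    unfolding h_def using f g unfolding hyp_continuation_def
    by (intro has_fps_expansion_cmult_left has_fps_expansion_add has_fps_expansion_diff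
         has_fps_expansion_mult has_fps_expansion_fps_X) auto
  also have "\<dots> = Abs_fps (hyp_coeff a b c)"
  proof (rule fps_ext)
    fix n
    have solve: "- 1 / (c - b - 1) * S = x" if "(c - b - 1) * x + S = 0" for S x
    proof -
      have "S = - ((c - b - 1) * x)" "c - b - 1 \<noteq> 0" using that c(2) by (auto simp: add_eq_0_iff algebra_simps)
      thus ?thesis by simp
    qed
    show "(fps_const (- 1 / (c - b - 1)) * (fps_const (2 * b + 2 - c) * ?F +
          fps_const (a - b - 1) * (fps_X * ?F) + fps_const (b + 1) * (fps_X * ?G) - fps_const (b + 1) * ?G)) $ n
        = Abs_fps (hyp_coeff a b c) $ n"
    proof (cases n)
      case 0
      show ?thesis unfolding 0 fps_mult_left_const_nth Abs_fps_inverse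
        by (subst solve[of "hyp_coeff a b c 0"]) (use hyp_coeff_contiguous(1)[OF c(1), of b a] in \<open>simp_all add: algebra_simps\<close>)
    next
      case (Suc m)
      show ?thesis unfolding Suc fps_mult_left_const_nth
        by (subst solve[of "hyp_coeff a b c (Suc m)"])
           (use hyp_coeff_contiguous(2)[OF c(1), of b a m] in \<open>simp_all add: algebra_simps\<close>)
    qed
  qed
  finally show ?thesis using f g
    by (auto simp: hyp_continuation_def h_def intro!: exI[of _ h] holomorphic_intros)
qed

text \<open>Euler's integral covers \<open>0 < Re b < Re c\<close>; contiguity then lowers \<open>b\<close>, and
  \<open>1 + (z / c) d/dz\<close> lowers \<open>c\<close>.\<close>

lemma hyp_continuation_exists:
  assumes c: "c \<notin> \<int>\<^sub>\<le>\<^sub>0"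
  shows "\<exists>f. hyp_continuation a b c f"
proof -
  \<comment> \<open>The bound 2 keeps the induction inside its range: in the new case Re b \<le> 0,
    so \<open>b + 1\<close> and \<open>b + 2\<close> still have real parts below Re c, and c differs
    from \<open>b + 1\<close>.\<close>
  have 1: "\<exists>f. hyp_continuation a b c f" if "Re c > 2" "Re b > - real k" "Re b < Re c" for k b c
    using that
  proof (induction k arbitrary: b)
    case 0
    thus ?case by (intro hyp_continuation_Euler_integral) auto
  next
    case (Suc k)
    show ?case
    proof (cases "Re b > - real k")
      case True
      thus ?thesis using Suc by auto
    next
      case False
      obtain f where f: "hyp_continuation a (b + 1) c f" using Suc.IH[of "b + 1"] Suc.prems False by auto
      obtain g where g: "hyp_continuation a (b + 2) c g" using Suc.IH[of "b + 2"] Suc.prems False by auto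
      have "c \<noteq> b + 1" using Suc.prems False by auto
      thus ?thesis using f g Suc.prems by (intro hyp_continuation_lower_b Re_pos_imp_not_nonpos_Int) auto
    qed
  qed
  have 2: "\<exists>f. hyp_continuation a b c f" if "hyp_continuation a b (c + of_nat k) f" for k f
    using that
  proof (induction k arbitrary: f)
    case (Suc k)
    have "hyp_continuation a b (c + of_nat k + 1) f" using Suc.prems by (simp add: add_ac)
    from hyp_continuation_lower_c[OF this] show ?case
      using Suc.IH not_nonpos_Int_add_of_nat[OF c] by blast
  qed auto
  \<comment> \<open>The shift makes Re(c + k) exceed both 2 and Re b, as claim \<open>1\<close>
    requires; claim \<open>2\<close> then descends back to c.\<close>
  obtain k where k: "real k > max 2 (Re b) - Re c" using reals_Archimedean2 by blast
  obtain l where l: "real l > - Re b" using reals_Archimedean2 by blast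
  have "\<exists>f. hyp_continuation a b (c + of_nat k) f"
    using k l by (intro 1[where k = l]) auto
  thus ?thesis using 2 by blast
qed

lemma ball_subset_slit_plane: "ball 0 1 \<subseteq> slit_plane"
proof
  fix z :: complex assume "z \<in> ball 0 1"
  thus "z \<in> slit_plane" using complex_Re_le_cmod[of z] by (simp add: mem_slit_plane_iff)
qed

text \<open>Once some continuation exists, the choice operator in \<open>hyp2F1\<close> meets its
  specification, and agreement on the unit disc fixes the Taylor series at 0.\<close>

lemma hyp2F1_continuation:
  assumes c: "c \<notin> \<int>\<^sub>\<le>\<^sub>0"
  shows "hyp_continuation a b c (hyp2F1 a b c)"
proof -
  obtain f where f: "f holomorphic_on slit_plane" "f has_fps_expansion fps_hypergeo [a, b] [c] 1"
    using hyp_continuation_exists[OF c] unfolding hyp_continuation_def fps_hypergeo_2_1_eq by blast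
  have "f holomorphic_on ball 0 1" using f(1) ball_subset_slit_plane holomorphic_on_subset by blast
  hence "is_hyp2F1_continuation a b c f"
    using f has_fps_expansion_imp_eval_fps_eq[OF f(2)]
    by (auto simp: is_hyp2F1_continuation_def slit_plane_def)
  hence *: "is_hyp2F1_continuation a b c (hyp2F1 a b c)"
    unfolding hyp2F1_def by (rule someI[where P = "is_hyp2F1_continuation a b c"])
  have "eventually (\<lambda>z. z \<in> ball 0 1) (nhds (0::complex))" by (rule eventually_nhds_in_open) auto
  hence "eventually (\<lambda>z. eval_fps (fps_hypergeo [a, b] [c] 1) z = hyp2F1 a b c z) (nhds 0)"
    by eventually_elim (use * in \<open>auto simp: is_hyp2F1_continuation_def\<close>)
  hence "hyp2F1 a b c has_fps_expansion fps_hypergeo [a, b] [c] 1"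
    using f(2) by (auto simp: has_fps_expansion_def)
  thus ?thesis using *
    by (auto simp: hyp_continuation_def is_hyp2F1_continuation_def slit_plane_def fps_hypergeo_2_1_eq)
qed

text \<open>The two specifications are the same predicate, so the choice operator returns the same
  function, on the cut as well.\<close>

lemma hyp2F1_commute: "hyp2F1 a b c = hyp2F1 b a c"
proof -
  have "hyp_coeff a b c = hyp_coeff b a c" by (simp add: hyp_coeff_def fun_eq_iff)
  thus ?thesis by (simp add: hyp2F1_def is_hyp2F1_continuation_def fps_hypergeo_2_1_eq)
qed

lemma hyp2F1_unit_disc:
  assumes c: "c \<notin> \<int>\<^sub>\<le>\<^sub>0" and z: "norm z < 1"
  shows "hyp2F1 a b c z = (\<Sum>n. hyp_coeff a b c n * z ^ n)"
    and "summable (\<lambda>n. norm (hyp_coeff a b c n * z ^ n))"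
proof -
  have f: "hyp2F1 a b c holomorphic_on ball 0 1" "hyp2F1 a b c has_fps_expansion Abs_fps (hyp_coeff a b c)"
    using hyp2F1_continuation[OF c] ball_subset_slit_plane
    by (auto simp: hyp_continuation_def intro: holomorphic_on_subset)
  show "hyp2F1 a b c z = (\<Sum>n. hyp_coeff a b c n * z ^ n)"
    using has_fps_expansion_imp_eval_fps_eq[OF f(2) z f(1)] by (simp add: eval_fps_def)
  have "hyp2F1 a b c holomorphic_on eball 0 1"
    using f(1) by (rule holomorphic_on_subset) (auto simp: eball_def one_ereal_def)
  hence "fps_conv_radius (Abs_fps (hyp_coeff a b c)) \<ge> 1"
    by (rule holomorphic_on_imp_fps_conv_radius_ge[OF f(2)])
  thus "summable (\<lambda>n. norm (hyp_coeff a b c n * z ^ n))"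
    using z abs_summable_in_conv_radius[of z "hyp_coeff a b c"] less_le_trans[of "ereal (norm z)" 1]
    by (simp add: fps_conv_radius_def)
qed

section \<open>Pfaff's transformation as an identity of formal power series\<close>

definition fps_one_minus_powr :: "complex \<Rightarrow> complex fps" where
  "fps_one_minus_powr s = Abs_fps (\<lambda>n. pochhammer s n / fact n)"

lemma has_fps_expansion_one_minus_powr:
  "(\<lambda>z. (1 - z) powr (- s)) has_fps_expansion fps_one_minus_powr s"
proof (rule has_fps_expansionI)
  have "eventually (\<lambda>z. z \<in> ball 0 1) (nhds (0::complex))" by (rule eventually_nhds_in_open) auto
  thus "\<forall>\<^sub>F z in nhds 0. (\<lambda>n. fps_one_minus_powr s $ n * z ^ n) sums (1 - z) powr (- s)"
    by eventually_elim (use sums_one_minus_powr(1) in \<open>auto simp: fps_one_minus_powr_def\<close>)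
qed

lemma fps_one_minus_powr_mult:
  "fps_one_minus_powr s * fps_one_minus_powr t = fps_one_minus_powr (s + t)"
proof (rule fps_expansion_unique_complex)
  have "(\<lambda>z::complex. (1 - z) powr (- s) * (1 - z) powr (- t)) = (\<lambda>z. (1 - z) powr (- (s + t)))"
    by (simp add: powr_add[symmetric])
  thus "(\<lambda>z. (1 - z) powr (- (s + t))) has_fps_expansion fps_one_minus_powr s * fps_one_minus_powr t"
    using has_fps_expansion_mult[OF has_fps_expansion_one_minus_powr[of s] has_fps_expansion_one_minus_powr[of t]]
    by simp
qed (rule has_fps_expansion_one_minus_powr)

lemma fps_one_minus_powr_1_power:
  "fps_one_minus_powr 1 ^ n = fps_one_minus_powr (of_nat n)"
proof (induction n)
  case 0
  show ?case by (auto simp: fps_one_minus_powr_def fps_eq_iff pochhammer_0_left)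
qed (simp add: fps_one_minus_powr_mult add.commute)

text \<open>Since \<open>G\<close> has no constant term, \<open>G ^ i\<close> starts at degree i.
  Only i \<le> n contributes, and the inner sums can all be extended to the same range before the
  order of summation is exchanged.\<close>

lemma fps_mult_compose_nth:
  fixes A F G :: "'a :: comm_ring_1 fps"
  assumes G: "G $ 0 = 0"
  shows "(A * (F oo G)) $ n = (\<Sum>i\<le>n. F $ i * (A * G ^ i) $ n)"
proof -
  have "(A * (F oo G)) $ n = (\<Sum>j\<le>n. A $ j * (\<Sum>i\<le>n. F $ i * (G ^ i) $ (n - j)))"
    unfolding fps_mult_nth atLeast0AtMost fps_compose_nth
    by (intro sum.cong refl arg_cong2[where f = "(*)"] sum.mono_neutral_left)
       (use startsby_zero_power_prefix[OF G] in auto)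
  also have "\<dots> = (\<Sum>i\<le>n. \<Sum>j\<le>n. A $ j * (F $ i * (G ^ i) $ (n - j)))"
    unfolding sum_distrib_left by (rule sum.swap)
  also have "\<dots> = (\<Sum>i\<le>n. F $ i * (A * G ^ i) $ n)"
    unfolding fps_mult_nth atLeast0AtMost sum_distrib_left by (simp add: mult_ac)
  finally show ?thesis .
qed

text \<open>The inner series is -X/(1-X), that is z/(z-1). Its i-th power times (1-X)^(-b) is (-1)^i
  X^i (1-X)^(-b-i), so the n-th coefficient is a terminating sum with upper parameters c - a and -n.
  Chu-Vandermonde evaluates it to (a)_n/(c)_n.\<close>

lemma fps_Pfaff:
  assumes c: "c \<notin> \<int>\<^sub>\<le>\<^sub>0"
  shows "fps_one_minus_powr b * (Abs_fps (hyp_coeff (c - a) b c) oo (- (fps_X * fps_one_minus_powr 1))) =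
           Abs_fps (hyp_coeff a b c)"
proof (rule fps_ext)
  fix n
  define G where "G = - (fps_X * fps_one_minus_powr 1)"
  have summand: "hyp_coeff (c - a) b c i * (fps_one_minus_powr b * G ^ i) $ n =
      pochhammer b n / fact n * (pochhammer (c - a) i * pochhammer (- of_nat n) i / (of_nat (fact i) * pochhammer c i))"
    if i: "i \<le> n" for i
  proof -
    have "G = fps_const (- 1) * (fps_X * fps_one_minus_powr 1)" by (simp add: G_def fps_eq_iff)
    hence "G ^ i = fps_const ((-1) ^ i) * (fps_X ^ i * fps_one_minus_powr (of_nat i))"
      by (simp only: power_mult_distrib fps_const_power fps_one_minus_powr_1_power)
    hence "fps_one_minus_powr b * G ^ i = fps_const ((-1) ^ i) * (fps_X ^ i * fps_one_minus_powr (b + of_nat i))"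
      by (simp only: fps_one_minus_powr_mult[symmetric] mult_ac)
    hence 1: "(fps_one_minus_powr b * G ^ i) $ n = (-1) ^ i * (pochhammer (b + of_nat i) (n - i) / fact (n - i))"
      using i by (simp add: fps_X_power_mult_nth fps_one_minus_powr_def)
    have 2: "pochhammer b i * pochhammer (b + of_nat i) (n - i) = pochhammer b n"
      using i by (rule pochhammer_product[symmetric])
    \<comment> \<open>Both sides are the binomial coefficient n over i; this converts 1/(n-i)! into
      the symbol (-n)_i that Chu-Vandermonde expects.\<close>
    have 3: "(-1) ^ i * pochhammer (- of_nat n) i / fact i = (fact n / (fact i * fact (n - i)) :: complex)"
      using i by (simp add: gbinomial_pochhammer[symmetric] binomial_gbinomial[symmetric] binomial_fact)
    have "(-1) ^ i * pochhammer (- of_nat n) i = fact i * ((-1) ^ i * pochhammer (- of_nat n) i / fact i :: complex)"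
      by simp
    also have "\<dots> = fact n / fact (n - i)" unfolding 3 by simp
    finally have "(-1) ^ i * pochhammer (- of_nat n) i = (fact n / fact (n - i) :: complex)" .
    hence "(-1) ^ i * ((-1) ^ i * pochhammer (- of_nat n) i) = (-1) ^ i * (fact n / fact (n - i) :: complex)"
      by simp
    hence 3: "(-1) ^ i / fact (n - i) = (pochhammer (- of_nat n) i / fact n :: complex)" by simp
    have "hyp_coeff (c - a) b c i * (fps_one_minus_powr b * G ^ i) $ n =
      pochhammer (c - a) i / (pochhammer c i * fact i) *
        (pochhammer b i * pochhammer (b + of_nat i) (n - i)) * ((-1) ^ i / fact (n - i))"
      unfolding 1 hyp_coeff_def by simp
    thus ?thesis unfolding 2 3 by (simp add: mult_ac)
  qed
  have "(fps_one_minus_powr b * (Abs_fps (hyp_coeff (c - a) b c) oo G)) $ n =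
     (\<Sum>i\<le>n. hyp_coeff (c - a) b c i * (fps_one_minus_powr b * G ^ i) $ n)"
    by (subst fps_mult_compose_nth) (simp_all add: G_def)
  also have "\<dots> = pochhammer b n / fact n *
     (\<Sum>i=0..n. pochhammer (c - a) i * pochhammer (- of_nat n) i / (of_nat (fact i) * pochhammer c i))"
    unfolding sum_distrib_left atLeast0AtMost by (intro sum.cong refl summand) auto
  also have "\<dots> = pochhammer b n / fact n * (pochhammer (c - (c - a)) n / pochhammer c n)"
    by (subst Vandermonde_pochhammer) (use c in auto)
  also have "\<dots> = Abs_fps (hyp_coeff a b c) $ n" by (simp add: hyp_coeff_def mult_ac)
  finally show "(fps_one_minus_powr b * (Abs_fps (hyp_coeff (c - a) b c) oo (- (fps_X * fps_one_minus_powr 1)))) $ n =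
      Abs_fps (hyp_coeff a b c) $ n" by (simp add: G_def)
qed

text \<open>The map z -> z/(z-1) is an involution that sends (1,\<infinity>) to itself, so a point
  mapped into the cut would already lie on it.\<close>

lemma slit_plane_Pfaff:
  assumes "z \<in> slit_plane" shows "z / (z - 1) \<in> slit_plane"
proof -
  have "False" if "z / (z - 1) = complex_of_real r" "r \<ge> 1" for r
  proof -
    have "z \<noteq> 1" using assms by (auto simp: mem_slit_plane_iff)
    hence *: "z * (of_real r - 1) = of_real r" using that(1) by (simp add: field_simps)
    have "r \<noteq> 1" using * by auto
    hence "z = of_real (r / (r - 1))" using * that by (simp add: field_simps)
    moreover have "r / (r - 1) \<ge> 1" using that \<open>r \<noteq> 1\<close> by (simp add: field_simps)
    ultimately show False using assms unfolding slit_plane_def by blast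
  qed
  thus ?thesis by (auto simp: slit_plane_def)
qed

theorem hyp2F1_Pfaff:
  assumes c: "c \<notin> \<int>\<^sub>\<le>\<^sub>0" and z: "z \<in> slit_plane"
  shows "hyp2F1 a b c z = (1 - z) powr (- b) * hyp2F1 (c - a) b c (z / (z - 1))"
proof (rule holomorphic_slit_plane_eqI[OF _ _ _ _ z])
  have F: "hyp2F1 a' b c holomorphic_on slit_plane" "hyp2F1 a' b c has_fps_expansion Abs_fps (hyp_coeff a' b c)" for a'
    using hyp2F1_continuation[OF c] by (auto simp: hyp_continuation_def)
  show "hyp2F1 a b c holomorphic_on slit_plane" "hyp2F1 a b c has_fps_expansion Abs_fps (hyp_coeff a b c)"
    by (rule F)+
  have ne1: "z \<noteq> 1" if "z \<in> slit_plane" for z using that by (auto simp: mem_slit_plane_iff)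
  have "(hyp2F1 (c - a) b c \<circ> (\<lambda>z. z / (z - 1))) holomorphic_on slit_plane"
    using slit_plane_Pfaff ne1
    by (intro holomorphic_on_compose_gen[OF _ F(1)] holomorphic_intros) auto
  thus "(\<lambda>z. (1 - z) powr (- b) * hyp2F1 (c - a) b c (z / (z - 1))) holomorphic_on slit_plane"
    using one_minus_slit_plane by (intro holomorphic_intros) (auto simp: o_def)
  have "(\<lambda>z. - (z * (1 - z) powr (- 1))) has_fps_expansion - (fps_X * fps_one_minus_powr 1)"
    by (intro fps_expansion_intros has_fps_expansion_one_minus_powr)
  also have "(\<lambda>z::complex. - (z * (1 - z) powr (- 1))) = (\<lambda>z. z / (z - 1))"
  proof
    fix z :: complex
    show "- (z * (1 - z) powr (- 1)) = z / (z - 1)"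
      \<comment> \<open>At \<open>z = 1\<close> both sides are 0 by convention: a power of 0 on the
        left, a division by 0 on the right.\<close>
      by (cases "z = 1") (auto simp: powr_minus field_simps)
  qed
  finally have "(hyp2F1 (c - a) b c \<circ> (\<lambda>z. z / (z - 1))) has_fps_expansion
     (Abs_fps (hyp_coeff (c - a) b c) oo (- (fps_X * fps_one_minus_powr 1)))"
    by (intro has_fps_expansion_compose F) auto
  hence "(\<lambda>z. (1 - z) powr (- b) * hyp2F1 (c - a) b c (z / (z - 1))) has_fps_expansion
     fps_one_minus_powr b * (Abs_fps (hyp_coeff (c - a) b c) oo (- (fps_X * fps_one_minus_powr 1)))"
    by (intro has_fps_expansion_mult has_fps_expansion_one_minus_powr) (simp add: o_def)
  thus "(\<lambda>z. (1 - z) powr (- b) * hyp2F1 (c - a) b c (z / (z - 1))) has_fps_expansion Abs_fps (hyp_coeff a b c)"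
    using fps_Pfaff[OF c] by simp
qed

section \<open>The integral transforms\<close>

text \<open>Termwise Beta integration yields Beta(c,s) (c)_n/(c+s)_n, which replaces the lower
  parameter c by c + s. The result is Beta(c,s) F(a,b;c+s;1), and \<open>abc\<close> is the
  convergence condition of Gauss' sum.\<close>

theorem has_bochner_integral_Beta_hyp2F1:
  assumes c: "Re c > 0" and s: "Re s > 0" and abc: "Re (c + s - a - b) > 0"
  shows "has_bochner_integral lborel01
     (\<lambda>y. of_real y powr (c - 1) * of_real (1 - y) powr (s - 1) * hyp2F1 a b c (of_real y))
     (Gamma c * Gamma s * Gamma (c + s - a - b) * rGamma (c + s - a) * rGamma (c + s - b))"
proof -
  have nz: "c \<notin> \<int>\<^sub>\<le>\<^sub>0" "s \<notin> \<int>\<^sub>\<le>\<^sub>0" "c + s \<notin> \<int>\<^sub>\<le>\<^sub>0" using c s by (auto intro!: Re_pos_imp_not_nonpos_Int)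
  define p where "p = (\<lambda>n y. hyp_coeff a b c n * (of_real y powr (c + of_nat n - 1) * of_real (1 - y) powr (s - 1)))"
  have p_eq: "p n y = of_real y powr (c - 1) * of_real (1 - y) powr (s - 1) * (hyp_coeff a b c n * of_real y ^ n)"
    if "y \<in> {0<..<1}" for n y
  proof -
    have "complex_of_real y powr (c + of_nat n - 1) = of_real y powr ((c - 1) + of_nat n)"
      by (simp add: algebra_simps)
    also have "\<dots> = of_real y powr (c - 1) * of_real y ^ n"
      using that by (subst powr_add) (simp add: powr_nat)
    finally show ?thesis by (simp add: p_def)
  qed
  have p_int: "has_bochner_integral lborel01 (p n) (hyp_coeff a b c n * Beta (c + of_nat n) s)" for n
    unfolding p_def by (intro has_bochner_integral_mult_right has_bochner_integral_Beta_complex) (use c s in auto)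
  have p_norm: "(\<integral>y. norm (p n y) \<partial>lborel01) = norm (hyp_coeff a b c n) * Beta (Re c + real n) (Re s)" for n
  proof -
    have "(\<integral>y. norm (p n y) \<partial>lborel01) =
            (\<integral>y. norm (hyp_coeff a b c n) * (y powr (Re c + real n - 1) * (1 - y) powr (Re s - 1)) \<partial>lborel01)"
      unfolding p_def norm_mult[of "hyp_coeff a b c n"]
      by (intro Bochner_Integration.integral_cong refl) (subst norm_Beta_integrand, auto simp: space_lborel01)
    also have "\<dots> = norm (hyp_coeff a b c n) * Beta (Re c + real n) (Re s)"
      using has_bochner_integral_Beta_real[of "Re c + real n" "Re s"] c s
      by (simp add: has_bochner_integral_iff)
    finally show ?thesis .
  qed
  have p_summable: "summable (\<lambda>n. \<integral>y. norm (p n y) \<partial>lborel01)"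
  proof -
    obtain A where A: "\<And>n. n > 0 \<Longrightarrow> norm (hyp_coeff a b c (Suc n)) \<le> A * real n powr (Re (a + b - c) - 1)"
      using hyp_coeff_bound[OF nz(1)] by blast
    \<comment> \<open>Taking norms replaces the Beta parameters by their real parts. The extra ratio
      of Pochhammer symbols at \<open>x\<close> and \<open>x'\<close> decays like n^(-Re s), and
      with the growth of the coefficients the total exponent is below -1 by
      \<open>abc\<close>.\<close>
    define x where "x = complex_of_real (Re c)"
    define x' where "x' = complex_of_real (Re c + Re s)"
    have "x' \<notin> \<int>\<^sub>\<le>\<^sub>0" using c s by (intro Re_pos_imp_not_nonpos_Int) (simp add: x'_def)
    then obtain B where B: "\<And>n. n > 0 \<Longrightarrow>
        norm (pochhammer x (Suc n) / pochhammer x' (Suc n)) \<le> B * real n powr Re (x - x')"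
      using pochhammer_ratio_bound by blast
    define f where "f = (\<lambda>n. hyp_coeff a b c n * (pochhammer x n / pochhammer x' n))"
    have "summable (\<lambda>n. norm (f n))"
    proof (rule summable_norm_powr_boundI)
      fix n :: nat assume n: "n > 0"
      have "norm (f (Suc n)) \<le> (A * real n powr (Re (a + b - c) - 1)) * (B * real n powr Re (x - x'))"
        unfolding f_def norm_mult using n by (intro mult_mono A B order_trans[OF norm_ge_zero A]) auto
      also have "\<dots> = A * B * real n powr ((Re (a + b - c) - 1) + Re (x - x'))"
        using n by (simp add: powr_add)
      finally show "norm (f (Suc n)) \<le> A * B * real n powr ((Re (a + b - c) - 1) + Re (x - x'))" .
    qed (use abc in \<open>simp add: x_def x'_def\<close>)
    hence "summable (\<lambda>n. norm (f n) * Beta (Re c) (Re s))" by (rule summable_mult2)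
    also have "(\<lambda>n. norm (f n) * Beta (Re c) (Re s)) = (\<lambda>n. \<integral>y. norm (p n y) \<partial>lborel01)"
    proof
      fix n
      have pos: "pochhammer (Re c) n > 0" "pochhammer (Re c + Re s) n > 0"
        using c s by (auto intro!: pochhammer_pos)
      have "Re c \<notin> \<int>\<^sub>\<le>\<^sub>0" "Re c + Re s \<notin> \<int>\<^sub>\<le>\<^sub>0" using c s by (auto elim!: nonpos_Ints_cases)
      thus "norm (f n) * Beta (Re c) (Re s) = (\<integral>y. norm (p n y) \<partial>lborel01)"
        unfolding p_norm f_def x_def x'_def pochhammer_of_real using pos
        by (subst Beta_add_of_nat) (auto simp: norm_mult norm_divide)
    qed
    finally show ?thesis .
  qed
  have y_summable: "summable (\<lambda>n. norm (hyp_coeff a b c n * of_real y ^ n))" if "y \<in> {0<..<1}" for y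
    using that by (intro hyp2F1_unit_disc(2) nz) auto
  have "integrable lborel01 (\<lambda>y. \<Sum>n. p n y)"
    and sums: "(\<lambda>n. integral\<^sup>L lborel01 (p n)) sums (\<integral>y. (\<Sum>n. p n y) \<partial>lborel01)"
  proof -
    have *: "AE y in lborel01. summable (\<lambda>n. norm (p n y))"
    proof (rule AE_I2)
      fix y assume y: "y \<in> space lborel01"
      hence "summable (\<lambda>n. norm (of_real y powr (c - 1) * of_real (1 - y) powr (s - 1)) * norm (hyp_coeff a b c n * of_real y ^ n))"
        by (intro summable_mult y_summable) (auto simp: space_lborel01)
      thus "summable (\<lambda>n. norm (p n y))"
        using y by (simp add: p_eq space_lborel01 norm_mult)
    qed
    show "integrable lborel01 (\<lambda>y. \<Sum>n. p n y)"
      using p_int by (intro integrable_suminf * p_summable) (auto simp: has_bochner_integral_iff)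
    show "(\<lambda>n. integral\<^sup>L lborel01 (p n)) sums (\<integral>y. (\<Sum>n. p n y) \<partial>lborel01)"
      using p_int by (intro sums_integral * p_summable) (auto simp: has_bochner_integral_iff)
  qed
  moreover have "(\<integral>y. (\<Sum>n. p n y) \<partial>lborel01) =
       Gamma c * Gamma s * Gamma (c + s - a - b) * rGamma (c + s - a) * rGamma (c + s - b)"
  proof -
    have "hyp_coeff a b (c + s) sums (Gamma (c + s) * Gamma (c + s - a - b) * rGamma (c + s - a) * rGamma (c + s - b))"
      by (rule Gauss_hypergeometric_sum) (use c s abc in auto)
    hence "(\<lambda>n. Beta c s * hyp_coeff a b (c + s) n) sums
              (Beta c s * (Gamma (c + s) * Gamma (c + s - a - b) * rGamma (c + s - a) * rGamma (c + s - b)))"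
      by (rule sums_mult)
    also have "(\<lambda>n. Beta c s * hyp_coeff a b (c + s) n) = (\<lambda>n. integral\<^sup>L lborel01 (p n))"
    proof
      fix n
      have "integral\<^sup>L lborel01 (p n) = hyp_coeff a b c n * Beta (c + of_nat n) s"
        using p_int[of n] by (simp add: has_bochner_integral_iff)
      also have "\<dots> = Beta c s * hyp_coeff a b (c + s) n"
        using nz pochhammer_nonzero by (simp add: Beta_add_of_nat hyp_coeff_def mult_ac)
      finally show "Beta c s * hyp_coeff a b (c + s) n = integral\<^sup>L lborel01 (p n)" ..
    qed
    also have "Beta c s * (Gamma (c + s) * Gamma (c + s - a - b) * rGamma (c + s - a) * rGamma (c + s - b)) =
        Gamma c * Gamma s * Gamma (c + s - a - b) * rGamma (c + s - a) * rGamma (c + s - b)"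
      using nz by (simp add: Beta_def Gamma_eq_zero_iff)
    finally show ?thesis using sums sums_unique2 by blast
  qed
  ultimately have "has_bochner_integral lborel01 (\<lambda>y. \<Sum>n. p n y)
       (Gamma c * Gamma s * Gamma (c + s - a - b) * rGamma (c + s - a) * rGamma (c + s - b))"
    by (simp add: has_bochner_integral_iff)
  also have "?this \<longleftrightarrow> ?thesis"
  proof (rule has_bochner_integral_cong[OF refl _ refl])
    fix y assume y: "y \<in> space lborel01"
    thus "(\<Sum>n. p n y) = of_real y powr (c - 1) * of_real (1 - y) powr (s - 1) * hyp2F1 a b c (of_real y)"
      using summable_norm_cancel[OF y_summable] nz
      by (simp add: p_eq space_lborel01 suminf_mult hyp2F1_unit_disc(1) del: of_real_diff)
  qed
  finally show ?thesis .
qed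


section \<open>The transform of \<open>w1\<close>\<close>

lemma of_real_powr_eq_exp: "x > 0 \<Longrightarrow> complex_of_real x powr w = exp (w * of_real (ln x))"
  by (simp add: powr_def Ln_of_real)

lemma of_real_powr_mult:
  assumes "x > 0" "y > 0"
  shows "complex_of_real (x * y) powr w = of_real x powr w * of_real y powr w"
  using assms unfolding of_real_mult by (intro powr_times_real) auto

context
  fixes a b c \<mu> :: complex
  assumes a\<mu>: "Re (- a - \<mu> + 1) > 0" and bc\<mu>: "Re (b - c - \<mu> + 1) > 0" and c: "Re c > 0"
    and ba\<mu>: "b - a - \<mu> + 1 \<notin> \<int>\<^sub>\<le>\<^sub>0"
begin

definition w1_kernel :: "real \<Rightarrow> complex" where
  "w1_kernel t = of_real t powr (b - c - \<mu>) * of_real (1 - t) powr (c - 1) * hyp2F1 a b c (of_real (1 - t))"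

definition w1_const :: complex where
  "w1_const = Gamma (- a - \<mu> + 1) * Gamma (b - c - \<mu> + 1) * Gamma c * rGamma (b - a - \<mu> + 1) * rGamma (1 - \<mu>)"

text \<open>The factor t^n only raises the exponent parameter s by n, so each moment is one instance
  of the previous integral, reflected by y = 1 - t.\<close>

lemma w1_kernel_moment:
  "has_bochner_integral lborel01 (\<lambda>t. w1_kernel t * of_real t ^ n)
     (Gamma c * Gamma (b - c - \<mu> + 1 + of_nat n) * Gamma (- a - \<mu> + 1 + of_nat n) *
        rGamma (b - a - \<mu> + 1 + of_nat n) * rGamma (1 - \<mu> + of_nat n))"
proof -
  define s where "s = b - c - \<mu> + 1 + of_nat n"
  have *: "c + s - a - b = - a - \<mu> + 1 + of_nat n" "c + s - a = b - a - \<mu> + 1 + of_nat n"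
    "c + s - b = 1 - \<mu> + of_nat n" by (simp_all add: s_def)
  have "has_bochner_integral lborel01
     (\<lambda>y. of_real y powr (c - 1) * of_real (1 - y) powr (s - 1) * hyp2F1 a b c (of_real y))
     (Gamma c * Gamma s * Gamma (c + s - a - b) * rGamma (c + s - a) * rGamma (c + s - b))"
    by (rule has_bochner_integral_Beta_hyp2F1) (use a\<mu> bc\<mu> c in \<open>auto simp: s_def\<close>)
  note has_bochner_integral_lborel01_reflect[OF this, unfolded *(1), unfolded *(2,3)]
  also have "has_bochner_integral lborel01 (\<lambda>y. of_real (1 - y) powr (c - 1) * of_real (1 - (1 - y)) powr (s - 1) *
        hyp2F1 a b c (of_real (1 - y))) = has_bochner_integral lborel01 (\<lambda>t. w1_kernel t * of_real t ^ n)"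
  proof (intro ext has_bochner_integral_cong refl)
    fix t assume "t \<in> space lborel01"
    hence t: "t > 0" by (simp add: space_lborel01)
    have "complex_of_real t powr (s - 1) = of_real t powr ((b - c - \<mu>) + of_nat n)" by (simp add: s_def algebra_simps)
    also have "\<dots> = of_real t powr (b - c - \<mu>) * of_real t ^ n"
      using t by (subst powr_add) (simp add: powr_nat)
    finally show "of_real (1 - t) powr (c - 1) * of_real (1 - (1 - t)) powr (s - 1) *
        hyp2F1 a b c (of_real (1 - t)) = w1_kernel t * of_real t ^ n"
      by (simp add: w1_kernel_def)
  qed
  finally show ?thesis by (simp only: s_def)
qed

lemma integrable_w1_kernel: "integrable lborel01 w1_kernel"
  using w1_kernel_moment[of 0] by (simp add: has_bochner_integral_iff)

lemma w1_kernel_integral: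
  assumes z: "z \<in> slit_plane"
  shows "(\<integral>t. w1_kernel t * (1 - z * of_real t) powr (- (1 - \<mu>)) \<partial>lborel01) =
           w1_const * hyp2F1 (- a - \<mu> + 1) (b - c - \<mu> + 1) (b - a - \<mu> + 1) z"
proof (rule holomorphic_slit_plane_eqI[OF _ _ _ _ z])
  let ?F = "Abs_fps (hyp_coeff (- a - \<mu> + 1) (b - c - \<mu> + 1) (b - a - \<mu> + 1))"
  have F: "hyp2F1 (- a - \<mu> + 1) (b - c - \<mu> + 1) (b - a - \<mu> + 1) holomorphic_on slit_plane"
    "hyp2F1 (- a - \<mu> + 1) (b - c - \<mu> + 1) (b - a - \<mu> + 1) has_fps_expansion ?F"
    using hyp2F1_continuation[OF ba\<mu>] by (auto simp: hyp_continuation_def)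
  show "(\<lambda>z. \<integral>t. w1_kernel t * (1 - z * of_real t) powr (- (1 - \<mu>)) \<partial>lborel01) holomorphic_on slit_plane"
    by (rule holomorphic_slit_kernel[OF integrable_w1_kernel])
  show "(\<lambda>z. w1_const * hyp2F1 (- a - \<mu> + 1) (b - c - \<mu> + 1) (b - a - \<mu> + 1) z) holomorphic_on slit_plane"
    by (intro holomorphic_intros F)
  show "(\<lambda>z. w1_const * hyp2F1 (- a - \<mu> + 1) (b - c - \<mu> + 1) (b - a - \<mu> + 1) z) has_fps_expansion fps_const w1_const * ?F"
    by (intro has_fps_expansion_cmult_left F)
  have "Abs_fps (\<lambda>n. pochhammer (1 - \<mu>) n / fact n * (\<integral>t. w1_kernel t * of_real t ^ n \<partial>lborel01)) = fps_const w1_const * ?F"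
  proof (rule fps_ext)
    fix n
    have nz: "- a - \<mu> + 1 \<notin> \<int>\<^sub>\<le>\<^sub>0" "b - c - \<mu> + 1 \<notin> \<int>\<^sub>\<le>\<^sub>0" using a\<mu> bc\<mu> Re_pos_imp_not_nonpos_Int by blast+
    have G: "Gamma (u + of_nat n) = pochhammer u n * Gamma u" if "u \<notin> \<int>\<^sub>\<le>\<^sub>0" for u :: complex
      using that by (simp add: pochhammer_Gamma Gamma_eq_zero_iff)
    have r: "rGamma (b - a - \<mu> + 1 + of_nat n) = rGamma (b - a - \<mu> + 1) / pochhammer (b - a - \<mu> + 1) n"
      using pochhammer_rGamma[of "b - a - \<mu> + 1" n] pochhammer_nonzero[OF ba\<mu>, of n] by simp
    \<comment> \<open>The factors are grouped so that (1-\<mu>)_n meets 1/Gamma(1-\<mu>+n). Their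
      product is 1/Gamma(1-\<mu>) even where Gamma has a pole.\<close>
    have "pochhammer (1 - \<mu>) n / fact n * (\<integral>t. w1_kernel t * of_real t ^ n \<partial>lborel01) =
       Gamma c * Gamma (b - c - \<mu> + 1 + of_nat n) * Gamma (- a - \<mu> + 1 + of_nat n) * rGamma (b - a - \<mu> + 1 + of_nat n) *
         (pochhammer (1 - \<mu>) n * rGamma (1 - \<mu> + of_nat n)) / fact n"
      using w1_kernel_moment[of n] by (simp add: has_bochner_integral_iff)
    also have "\<dots> = w1_const * hyp_coeff (- a - \<mu> + 1) (b - c - \<mu> + 1) (b - a - \<mu> + 1) n"
      unfolding pochhammer_rGamma[symmetric] r G[OF nz(1)] G[OF nz(2)] w1_const_def hyp_coeff_def
      by (simp add: mult_ac)
    finally show "Abs_fps (\<lambda>n. pochhammer (1 - \<mu>) n / fact n * (\<integral>t. w1_kernel t * of_real t ^ n \<partial>lborel01)) $ n =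
        (fps_const w1_const * ?F) $ n" by simp
  qed
  thus "(\<lambda>z. \<integral>t. w1_kernel t * (1 - z * of_real t) powr (- (1 - \<mu>)) \<partial>lborel01) has_fps_expansion fps_const w1_const * ?F"
    using has_fps_expansion_slit_kernel[OF integrable_w1_kernel, of "1 - \<mu>"] by simp
qed

lemma has_bochner_integral_w1:
  assumes x: "x < 0 \<or> x > 1"
  shows "has_bochner_integral lborel01
           (\<lambda>y. of_real y powr (c - 1) * of_real (1 - y) powr (b - c - \<mu>) * w1 y a b c * of_real \<bar>x - y\<bar> powr (\<mu> - 1))
           (w1_const * of_real \<bar>x\<bar> powr (c + \<mu> - 1) * of_real \<bar>x - 1\<bar> powr (b - c) * w4 x (a + \<mu>) b (c + \<mu>))"
proof -
  define z where "z = 1 / (1 - x)"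
  define P where "P = \<bar>x\<bar>"
  define Q where "Q = \<bar>x - 1\<bar>"
  have pos: "P > 0" "Q > 0" using x by (auto simp: P_def Q_def)
  have z1: "z < 1" using x by (auto simp: z_def divide_simps)
  have zt: "1 - z * t > 0" if "t \<in> {0<..<1}" for t
  proof (cases "z \<ge> 0")
    case True
    hence "z * t \<le> z" using that by (intro mult_left_le) auto
    thus ?thesis using z1 by simp
  next
    case False
    hence "z * t \<le> 0" using that by (intro mult_nonpos_nonneg) auto
    thus ?thesis by simp
  qed
  have z_slit: "of_real z \<in> slit_plane" using z1 by (simp add: mem_slit_plane_iff)
  have "has_bochner_integral lborel01 (\<lambda>t. w1_kernel t * (1 - of_real z * of_real t) powr (- (1 - \<mu>)))
          (w1_const * hyp2F1 (- a - \<mu> + 1) (b - c - \<mu> + 1) (b - a - \<mu> + 1) (of_real z))"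
    using integrable_slit_kernel[OF integrable_w1_kernel z_slit, of "1 - \<mu>"] w1_kernel_integral[OF z_slit]
    by (simp add: has_bochner_integral_iff)
  from has_bochner_integral_mult_right[OF has_bochner_integral_lborel01_reflect[OF this], of "of_real Q powr (\<mu> - 1)"]
  have "has_bochner_integral lborel01 (\<lambda>y. of_real Q powr (\<mu> - 1) * (w1_kernel (1 - y) *
          (1 - of_real z * of_real (1 - y)) powr (- (1 - \<mu>))))
          (of_real Q powr (\<mu> - 1) * (w1_const * hyp2F1 (- a - \<mu> + 1) (b - c - \<mu> + 1) (b - a - \<mu> + 1) (of_real z)))"
    by simp
  also have "?this \<longleftrightarrow> ?thesis"
  proof (rule has_bochner_integral_cong[OF refl])
    fix y assume "y \<in> space lborel01"
    hence y: "y \<in> {0<..<1}" by (simp add: space_lborel01)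
    \<comment> \<open>This factors x - y as (x-1)(1 - z(1-y)). The second factor is positive because
      z < 1, so the power of |x - y| splits into two powers of positive bases.\<close>
    have "(x - 1) * z = -1" using x by (auto simp: z_def field_simps)
    hence "x - y = (x - 1) * (1 - z * (1 - y))" by algebra
    hence "\<bar>x - y\<bar> = \<bar>(x - 1) * (1 - z * (1 - y))\<bar>" by simp
    also have "\<dots> = Q * (1 - z * (1 - y))" using zt[of "1 - y"] y by (simp add: abs_mult Q_def)
    finally have "complex_of_real \<bar>x - y\<bar> powr (\<mu> - 1) = of_real Q powr (\<mu> - 1) * of_real (1 - z * (1 - y)) powr (\<mu> - 1)"
      using pos zt[of "1 - y"] y by (simp only:) (rule of_real_powr_mult, auto)
    thus "of_real Q powr (\<mu> - 1) * (w1_kernel (1 - y) * (1 - of_real z * of_real (1 - y)) powr (- (1 - \<mu>))) =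
       of_real y powr (c - 1) * of_real (1 - y) powr (b - c - \<mu>) * w1 y a b c * of_real \<bar>x - y\<bar> powr (\<mu> - 1)"
      by (simp add: w1_kernel_def w1_def)
  next
    have x0: "of_real (inverse x) \<in> slit_plane" using x by (auto simp: mem_slit_plane_iff field_simps)
    \<comment> \<open>Pfaff's map sends 1/x, the argument in \<open>w4\<close>, to z =
      1/(1-x).\<close>
    have inv: "complex_of_real (inverse x) / (of_real (inverse x) - 1) = of_real z"
    proof -
      have "x \<noteq> 0" "x \<noteq> 1" using x by auto
      hence "inverse x / (inverse x - 1) = z" by (simp add: z_def divide_simps)
      thus ?thesis by (metis of_real_1 of_real_diff of_real_divide)
    qed
    have "1 - inverse x = Q / P" using x by (auto simp: P_def Q_def field_simps)
    hence "complex_of_real (1 - inverse x) powr (- (b - c - \<mu> + 1)) = of_real (Q / P) powr (- (b - c - \<mu> + 1))" by simp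
    also have "\<dots> = exp (- (b - c - \<mu> + 1) * (of_real (ln Q) - of_real (ln P)))"
      using pos by (subst of_real_powr_eq_exp) (auto simp: ln_div)
    finally have q: "(1 - complex_of_real (inverse x)) powr (- (b - c - \<mu> + 1)) =
         exp (- (b - c - \<mu> + 1) * (of_real (ln Q) - of_real (ln P)))" by simp
    define E where "E = exp (- (b - c - \<mu> + 1) * (complex_of_real (ln Q) - of_real (ln P)))"
    define H where "H = hyp2F1 (- a - \<mu> + 1) (b - c - \<mu> + 1) (b - a - \<mu> + 1) (of_real z)"
    have "hyp2F1 b (b - c - \<mu> + 1) (b - a - \<mu> + 1) (of_real (inverse x)) = E * H"
      using hyp2F1_Pfaff[OF ba\<mu> x0, of b "b - c - \<mu> + 1"] unfolding inv q E_def H_def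
      by (simp add: algebra_simps)
    moreover have "w4 x (a + \<mu>) b (c + \<mu>) = of_real P powr (- b) *
         hyp2F1 b (b - c - \<mu> + 1) (b - a - \<mu> + 1) (of_real (inverse x))"
      by (simp add: w4_def P_def algebra_simps)
    ultimately have w4: "w4 x (a + \<mu>) b (c + \<mu>) = of_real P powr (- b) * (E * H)" by simp
    \<comment> \<open>\<open>E\<close> is Pfaff's prefactor (Q/P)^(-(b-c-\<mu>+1)). The exponents of
      P add up to 0 and those of Q to \<mu> - 1, the power extracted from |x - y|.\<close>
    have powers: "of_real P powr (c + \<mu> - 1) * of_real Q powr (b - c) * (of_real P powr (- b) * E) =
        of_real Q powr (\<mu> - 1)"
      unfolding E_def of_real_powr_eq_exp[OF pos(1)] of_real_powr_eq_exp[OF pos(2)] exp_add[symmetric]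
      by (rule arg_cong[of _ _ exp]) algebra
    show "of_real Q powr (\<mu> - 1) * (w1_const * H) =
       w1_const * of_real \<bar>x\<bar> powr (c + \<mu> - 1) * of_real \<bar>x - 1\<bar> powr (b - c) * w4 x (a + \<mu>) b (c + \<mu>)"
      unfolding P_def[symmetric] Q_def[symmetric] w4 powers[symmetric] by (simp only: mult_ac)
  qed
  finally show ?thesis .
qed

end

section \<open>Inversion y = 1/u and the transform of \<open>w3\<close>\<close>

lemma inverse_image_unit_interval: "(\<lambda>u. 1 / u) ` {0<..<1::real} = {1<..}"
proof (intro equalityI subsetI)
  fix y :: real assume "y \<in> {1<..}"
  thus "y \<in> (\<lambda>u. 1 / u) ` {0<..<1}" by (intro image_eqI[of _ _ "1 / y"]) auto
qed auto

lemma has_bochner_integral_inverse_real: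
  fixes f :: "real \<Rightarrow> real"
  assumes "has_bochner_integral lborel01 (\<lambda>u. f (1 / u) / u\<^sup>2) I"
  shows "set_integrable lborel {1<..} f \<and> set_lebesgue_integral lborel {1<..} f = I"
proof -
  define h where "h = (\<lambda>u. f (1 / u) / u\<^sup>2)"
  have h: "set_integrable lborel {0<..<1} h" "set_lebesgue_integral lborel {0<..<1} h = I"
    using assms by (auto simp: has_bochner_integral_lborel01_iff h_def)
  have "h absolutely_integrable_on {0<..<1}"
    using h(1) unfolding set_integrable_def by (intro integrable_completion[THEN iffD2]) auto
  moreover have "integral {0<..<1} h = I"
    using set_borel_integral_eq_integral(2)[OF h(1)] h(2) by simp
  moreover have "h = (\<lambda>u. \<bar>- 1 / u\<^sup>2\<bar> * f (1 / u))" by (auto simp: h_def)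
  ultimately have "(\<lambda>u. \<bar>- 1 / u\<^sup>2\<bar> * f (1 / u)) absolutely_integrable_on {0<..<1} \<and>
      integral {0<..<1} (\<lambda>u. \<bar>- 1 / u\<^sup>2\<bar> * f (1 / u)) = I" by simp
  also have "?this \<longleftrightarrow> f absolutely_integrable_on ((\<lambda>u. 1 / u) ` {0<..<1}) \<and>
      integral ((\<lambda>u. 1 / u) ` {0<..<1}) f = I"
    by (rule has_absolute_integral_change_of_variables_1')
       (auto intro!: derivative_eq_intros inj_onI simp: power2_eq_square)
  finally have f: "f absolutely_integrable_on {1<..}" "integral {1<..} f = I"
    by (simp_all add: inverse_image_unit_interval)
  \<comment> \<open>The substitution yields integrability for the completed measure. Borel
    measurability is recovered separately, by pulling the measurable integrand \<open>k\<close> back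
    along y -> 1/y and removing the Jacobian.\<close>
  have meas: "(\<lambda>y. indicator {1<..} y *\<^sub>R f y) \<in> borel_measurable lborel"
  proof -
    define k where "k = (\<lambda>u. indicator {0<..<1} u *\<^sub>R h u)"
    have [measurable]: "k \<in> borel_measurable borel"
      using borel_measurable_integrable[OF h(1)[unfolded set_integrable_def]] by (simp add: k_def)
    have "(\<lambda>y. k (1 / y) * (1 / y)\<^sup>2) \<in> borel_measurable borel"
      by measurable
    also have "(\<lambda>y. k (1 / y) * (1 / y)\<^sup>2) = (\<lambda>y. indicator {1<..} y *\<^sub>R f y)"
    proof
      fix y :: real
      show "k (1 / y) * (1 / y)\<^sup>2 = indicator {1<..} y *\<^sub>R f y"
      proof (cases "y > 1")
        case True
        thus ?thesis by (simp add: k_def h_def power2_eq_square)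
      next
        case False
        \<comment> \<open>For y in (0,1] the reciprocal is at least 1; for y \<le> 0 it is
          nonpositive, with \<open>1 / 0 = 0\<close>.\<close>
        hence "1 / y \<notin> {0<..<1}" by (auto simp: divide_simps split: if_splits)
        thus ?thesis using False by (simp add: k_def)
      qed
    qed
    finally show ?thesis by simp
  qed
  have "set_integrable lborel {1<..} f"
    using f(1) meas unfolding set_integrable_def by (simp add: integrable_completion)
  moreover from this have "set_lebesgue_integral lborel {1<..} f = I"
    using f(2) by (simp add: set_borel_integral_eq_integral(2))
  ultimately show ?thesis by blast
qed

text \<open>The real substitution is applied to the real and imaginary parts, which are then
  recombined.\<close>

lemma has_lebesgue_integral_on_inverse:
  fixes f :: "real \<Rightarrow> complex"
  assumes "has_bochner_integral lborel01 (\<lambda>u. f (1 / u) / of_real (u\<^sup>2)) I"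
  shows "has_lebesgue_integral_on f I {1<..}"
proof -
  have "has_bochner_integral lborel01 (\<lambda>u. Re (f (1 / u) / of_real (u\<^sup>2))) (Re I)"
    "has_bochner_integral lborel01 (\<lambda>u. Im (f (1 / u) / of_real (u\<^sup>2))) (Im I)"
    by (rule has_bochner_integral_bounded_linear[OF bounded_linear_Re assms]
             has_bochner_integral_bounded_linear[OF bounded_linear_Im assms])+
  hence "has_bochner_integral lborel01 (\<lambda>u. Re (f (1 / u)) / u\<^sup>2) (Re I)"
    "has_bochner_integral lborel01 (\<lambda>u. Im (f (1 / u)) / u\<^sup>2) (Im I)"
    by (simp_all only: Re_divide_of_real Im_divide_of_real)
  from this[THEN has_bochner_integral_inverse_real]
  have re_im: "has_bochner_integral lborel (\<lambda>y. indicator {1<..} y * Re (f y)) (Re I)"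
    "has_bochner_integral lborel (\<lambda>y. indicator {1<..} y * Im (f y)) (Im I)"
    by (auto simp: has_bochner_integral_iff set_integrable_def set_lebesgue_integral_def)
  have "has_bochner_integral lborel (\<lambda>y. complex_of_real (indicator {1<..} y * Re (f y))) (of_real (Re I))"
    "has_bochner_integral lborel (\<lambda>y. complex_of_real (indicator {1<..} y * Im (f y))) (of_real (Im I))"
    by (rule re_im[THEN has_bochner_integral_bounded_linear[OF bounded_linear_of_real]])+
  hence "has_bochner_integral lborel (\<lambda>y. complex_of_real (indicator {1<..} y * Re (f y)) +
      \<i> * complex_of_real (indicator {1<..} y * Im (f y))) (of_real (Re I) + \<i> * of_real (Im I))"
    by (intro has_bochner_integral_add has_bochner_integral_mult_right) auto
  also have "(\<lambda>y. complex_of_real (indicator {1<..} y * Re (f y)) +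
      \<i> * complex_of_real (indicator {1<..} y * Im (f y))) = (\<lambda>y. indicator {1<..} y *\<^sub>R f y)"
    by (auto simp: fun_eq_iff indicator_def complex_eq_iff)
  finally show ?thesis
    by (simp add: has_lebesgue_integral_on_def set_integrable_def set_lebesgue_integral_def
       has_bochner_integral_iff complex_eq_iff)
qed

lemma has_lebesgue_integral_w1:
  assumes "Re (- a - \<mu> + 1) > 0" "Re (b - c - \<mu> + 1) > 0" "Re c > 0" "b - (a + \<mu>) + 1 \<notin> \<int>\<^sub>\<le>\<^sub>0"
    and "x \<in> {..<0} \<union> {1<..}"
  shows "has_lebesgue_integral_on
           (\<lambda>y. of_real y powr (c - 1) * of_real (1 - y) powr (b - c - \<mu>) *
                 w1 y a b c * of_real \<bar>x - y\<bar> powr (\<mu> - 1))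
           (Gamma (- a - \<mu> + 1) * Gamma (b - c - \<mu> + 1) * Gamma c *
             rGamma (b - a - \<mu> + 1) * rGamma (1 - \<mu>) *
             of_real \<bar>x\<bar> powr (c + \<mu> - 1) * of_real \<bar>x - 1\<bar> powr (b - c) *
             w4 x (a + \<mu>) b (c + \<mu>))
           {0<..<1}"
proof -
  have ba: "b - a - \<mu> + 1 \<notin> \<int>\<^sub>\<le>\<^sub>0" using assms(4) by (simp add: algebra_simps)
  have x: "x < 0 \<or> x > 1" using assms(5) by auto
  show ?thesis
    using has_bochner_integral_w1[OF assms(1-3) ba x]
    unfolding w1_const_def[OF assms(1-3) ba] has_bochner_integral_lborel01_iff has_lebesgue_integral_on_def .
qed

text \<open>At y = 1/u, \<open>w3\<close> equals u^a F(a,a-c+1;a-b+1;u), which dictates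
  \<open>b'\<close> and \<open>c'\<close>. Since b' - c' = b - c, the exponent of 1 - u is
  unchanged, and b' - a + 1 = 2 - c turns the third parameter of the resulting \<open>w4\<close> at
  1/x into that of \<open>w2\<close> at x.\<close>

lemma has_lebesgue_integral_w3:
  assumes a\<mu>: "Re (- a - \<mu> + 1) > 0" and bc\<mu>: "Re (b - c - \<mu> + 1) > 0" and ab: "Re (a - b + 1) > 0"
    and c\<mu>: "2 - (c + \<mu>) \<notin> \<int>\<^sub>\<le>\<^sub>0" and x: "x \<in> {..<0} \<union> {0<..<1}"
  shows "has_lebesgue_integral_on
           (\<lambda>y. of_real y powr (c - 1) * of_real (y - 1) powr (b - c - \<mu>) *
                 w3 y a b c * of_real (y - x) powr (\<mu> - 1))
           (Gamma (- a - \<mu> + 1) * Gamma (b - c - \<mu> + 1) * Gamma (a - b + 1) *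
             rGamma (- c - \<mu> + 2) * rGamma (1 - \<mu>) *
             of_real \<bar>x\<bar> powr (c + \<mu> - 1) * of_real \<bar>x - 1\<bar> powr (b - c) *
             w2 x (a + \<mu>) b (c + \<mu>))
           {1<..}" (is "has_lebesgue_integral_on ?f ?I _")
proof (rule has_lebesgue_integral_on_inverse)
  define X where "X = 1 / x"
  define P where "P = \<bar>x\<bar>"
  define Q where "Q = \<bar>x - 1\<bar>"
  define b' where "b' = a - c + 1"
  define c' where "c' = a - b + 1"
  define g where "g = (\<lambda>y. of_real y powr (c' - 1) * of_real (1 - y) powr (b' - c' - \<mu>) *
                 w1 y a b' c' * of_real \<bar>X - y\<bar> powr (\<mu> - 1))"
  define J where "J = Gamma (- a - \<mu> + 1) * Gamma (b' - c' - \<mu> + 1) * Gamma c' *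
             rGamma (b' - a - \<mu> + 1) * rGamma (1 - \<mu>) *
             of_real \<bar>X\<bar> powr (c' + \<mu> - 1) * of_real \<bar>X - 1\<bar> powr (b' - c') *
             w4 X (a + \<mu>) b' (c' + \<mu>)"
  have pos: "P > 0" "Q > 0" using x by (auto simp: P_def Q_def)
  have "has_lebesgue_integral_on g J {0<..<1}"
    unfolding g_def J_def
  proof (rule has_lebesgue_integral_w1)
    show "X \<in> {..<0} \<union> {1<..}" using x by (auto simp: X_def divide_simps)
  qed (use a\<mu> bc\<mu> ab c\<mu> in \<open>auto simp: b'_def c'_def algebra_simps\<close>)
  hence "has_bochner_integral lborel01 g J"
    by (simp add: has_bochner_integral_lborel01_iff has_lebesgue_integral_on_def)
  \<comment> \<open>The factor |x|^(\<mu>-1) turns |1/x - u| into 1 - u x, which is u times y - x at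
    y = 1/u.\<close>
  hence "has_bochner_integral lborel01 (\<lambda>u. of_real P powr (\<mu> - 1) * g u) (of_real P powr (\<mu> - 1) * J)"
    by (rule has_bochner_integral_mult_right)
  also have "?this \<longleftrightarrow> has_bochner_integral lborel01 (\<lambda>u. ?f (1 / u) / of_real (u\<^sup>2)) ?I"
  proof (rule has_bochner_integral_cong[OF refl])
    fix u assume "u \<in> space lborel01"
    hence u: "0 < u" "u < 1" by (auto simp: space_lborel01)
    define L M where "L = complex_of_real (ln u)" and "M = complex_of_real (ln (1 - u))"
    define R where "R = P * \<bar>X - u\<bar>"
    have ux: "u * x < 1"
    proof (cases "x < 0")
      case True
      thus ?thesis using u mult_pos_neg[of u x] by simp
    next
      case False
      thus ?thesis using u x mult_strict_mono[of u 1 x 1] by auto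
    qed
    have R: "R = 1 - u * x"
    proof -
      have "R = \<bar>x * (X - u)\<bar>" by (simp add: R_def P_def abs_mult)
      also have "x * (X - u) = 1 - u * x" using x by (auto simp: X_def algebra_simps)
      also have "\<bar>1 - u * x\<bar> = 1 - u * x" using ux by simp
      finally show ?thesis .
    qed
    have "R > 0" using ux by (simp add: R)
    hence Xu: "\<bar>X - u\<bar> > 0" by (auto simp: R_def)
    have 1: "of_real P powr (\<mu> - 1) * of_real \<bar>X - u\<bar> powr (\<mu> - 1) = complex_of_real R powr (\<mu> - 1)"
      unfolding R_def by (rule of_real_powr_mult[OF pos(1) Xu, symmetric])
    have 2: "complex_of_real (1 / u) powr w = exp (- w * L)" for w
      using u by (subst of_real_powr_eq_exp) (auto simp: L_def ln_div)
    have 3: "complex_of_real (1 / u - 1) powr w = exp (w * (M - L))" for w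
    proof -
      have "1 / u - 1 = (1 - u) / u" using u by (simp add: field_simps)
      thus ?thesis using u by (subst of_real_powr_eq_exp) (auto simp: L_def M_def ln_div)
    qed
    have 4: "complex_of_real (1 / u - x) powr w = of_real R powr w * exp (- w * L)" for w
    proof -
      have "1 / u - x = R * (1 / u)" using u by (simp add: R field_simps)
      thus ?thesis using u \<open>R > 0\<close> of_real_powr_mult[of R "1 / u" w] 2[of w] by simp
    qed
    have 5: "complex_of_real (u\<^sup>2) = exp (2 * L)"
    proof -
      have "exp (2 * L) = of_real (exp (ln u) ^ 2)"
        unfolding L_def of_real_power by (simp add: exp_double flip: exp_of_real)
      thus ?thesis using u by simp
    qed
    have w3: "w3 (1 / u) a b c = exp (a * L) * hyp2F1 a b' c' (of_real u)"
    proof -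
      have "w3 (1 / u) a b c = of_real (1 / u) powr (- a) * hyp2F1 a b' c' (of_real u)"
        using u by (simp add: w3_def b'_def c'_def)
      thus ?thesis unfolding 2 by simp
    qed
    have "of_real P powr (\<mu> - 1) * g u =
       of_real u powr (c' - 1) * of_real (1 - u) powr (b' - c' - \<mu>) * hyp2F1 a b' c' (of_real u) * of_real R powr (\<mu> - 1)"
      unfolding g_def 1[symmetric] by (simp add: w1_def mult_ac)
    also have "\<dots> = exp ((a - b) * L) * exp ((b - c - \<mu>) * M) * hyp2F1 a b' c' (of_real u) * of_real R powr (\<mu> - 1)"
      using u by (simp add: of_real_powr_eq_exp b'_def c'_def L_def M_def del: of_real_diff)
    also have "\<dots> = ?f (1 / u) / of_real (u\<^sup>2)"
      unfolding 2 3 4 5 w3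
    proof -
      \<comment> \<open>The factors on the right come, in order, from the powers of y and y - 1,
        from \<open>w3\<close>, from the kernel and from the Jacobian u^(-2). Equality is a linear
        identity in \<open>L\<close> and \<open>M\<close>.\<close>
      have "exp ((a - b) * L) * exp ((b - c - \<mu>) * M) = exp (- (c - 1) * L) * exp ((b - c - \<mu>) * (M - L)) *
              exp (a * L) * exp (- (\<mu> - 1) * L) * exp (- (2 * L))"
        unfolding exp_add[symmetric] by (rule arg_cong[of _ _ exp]) algebra
      hence "exp ((a - b) * L) * exp ((b - c - \<mu>) * M) * hyp2F1 a b' c' (of_real u) * of_real R powr (\<mu> - 1) =
          exp (- (c - 1) * L) * exp ((b - c - \<mu>) * (M - L)) * exp (a * L) * exp (- (\<mu> - 1) * L) * exp (- (2 * L)) *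
          hyp2F1 a b' c' (of_real u) * of_real R powr (\<mu> - 1)" by simp
      thus "exp ((a - b) * L) * exp ((b - c - \<mu>) * M) * hyp2F1 a b' c' (of_real u) * of_real R powr (\<mu> - 1) =
        exp (- (c - 1) * L) * exp ((b - c - \<mu>) * (M - L)) * (exp (a * L) * hyp2F1 a b' c' (of_real u)) *
        (of_real R powr (\<mu> - 1) * exp (- (\<mu> - 1) * L)) / exp (2 * L)"
        unfolding divide_inverse exp_minus[symmetric] by (simp only: mult_ac)
    qed
    finally show "of_real P powr (\<mu> - 1) * g u = ?f (1 / u) / of_real (u\<^sup>2)" .
  next
    define p q where "p = complex_of_real (ln P)" and "q = complex_of_real (ln Q)"
    define H where "H = hyp2F1 b' (b - c - \<mu> + 1) (2 - c - \<mu>) (of_real x)"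
    have x0: "x \<noteq> 0" "x \<noteq> 1" using x by auto
    have X: "\<bar>X\<bar> = 1 / P" "\<bar>X - 1\<bar> = Q / P"
    proof -
      show "\<bar>X\<bar> = 1 / P" by (simp add: X_def P_def)
      have "X - 1 = (1 - x) / x" using x0 by (simp add: X_def field_simps)
      thus "\<bar>X - 1\<bar> = Q / P" by (simp add: P_def Q_def abs_minus_commute)
    qed
    have 1: "complex_of_real \<bar>X\<bar> powr w = exp (- w * p)" for w
      unfolding X using pos by (subst of_real_powr_eq_exp) (auto simp: p_def ln_div)
    have 2: "complex_of_real \<bar>X - 1\<bar> powr w = exp (w * (q - p))" for w
      unfolding X using pos by (subst of_real_powr_eq_exp) (auto simp: p_def q_def ln_div)
    have w4: "w4 X (a + \<mu>) b' (c' + \<mu>) = exp (b' * p) * H"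
    proof -
      have eqs: "b' - (c' + \<mu>) + 1 = b - c - \<mu> + 1" "b' - (a + \<mu>) + 1 = 2 - c - \<mu>" "inverse X = x"
        by (simp_all add: b'_def c'_def X_def)
      show ?thesis unfolding w4_def 1 eqs H_def by simp
    qed
    have w2: "w2 x (a + \<mu>) b (c + \<mu>) = of_real P powr (1 - c - \<mu>) * H"
    proof -
      have eqs: "a + \<mu> - (c + \<mu>) + 1 = b'" "b - (c + \<mu>) + 1 = b - c - \<mu> + 1" "2 - (c + \<mu>) = 2 - c - \<mu>"
           "1 - (c + \<mu>) = 1 - c - \<mu>"
        by (simp_all add: b'_def)
      show ?thesis unfolding w2_def P_def[symmetric] eqs H_def ..
    qed
    define K where "K = Gamma (- a - \<mu> + 1) * Gamma (b - c - \<mu> + 1) * Gamma (a - b + 1) * rGamma (- c - \<mu> + 2) * rGamma (1 - \<mu>)"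
    have "J = K * exp (- (c' + \<mu> - 1) * p) * exp ((b' - c') * (q - p)) * (exp (b' * p) * H)"
    proof -
      have eqs: "b' - c' - \<mu> + 1 = b - c - \<mu> + 1" "b' - a - \<mu> + 1 = - c - \<mu> + 2" by (simp_all add: b'_def c'_def)
      show ?thesis unfolding J_def 1 2 w4 eqs K_def by (simp add: c'_def)
    qed
    moreover have "?I = K * exp ((c + \<mu> - 1) * p) * exp ((b - c) * q) * (exp ((1 - c - \<mu>) * p) * H)"
      unfolding w2 P_def[symmetric] Q_def[symmetric] using pos by (simp add: of_real_powr_eq_exp K_def p_def q_def)
    moreover have "of_real P powr (\<mu> - 1) = exp ((\<mu> - 1) * p)"
      using pos by (simp add: of_real_powr_eq_exp p_def)
    \<comment> \<open>On both sides the powers of |x| cancel completely and only |x - 1|^(b-c) is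
      left; on the right the power inside \<open>w2\<close> cancels the outer one.\<close>
    moreover have "exp ((\<mu> - 1) * p) * exp (- (c' + \<mu> - 1) * p) * exp ((b' - c') * (q - p)) * exp (b' * p) =
       exp ((c + \<mu> - 1) * p) * exp ((b - c) * q) * exp ((1 - c - \<mu>) * p)"
      unfolding exp_add[symmetric] b'_def c'_def by (rule arg_cong[of _ _ exp]) algebra
    ultimately show "of_real P powr (\<mu> - 1) * J = ?I"
      by (simp add: mult_ac)
  qed
  finally show "has_bochner_integral lborel01 (\<lambda>u. ?f (1 / u) / of_real (u\<^sup>2)) ?I" .
qed

theorem mainTheorem10:
  fixes a b c \<mu> :: complex
  shows
    "((Re (- a - \<mu> + 1) > 0 \<and> Re (b - c - \<mu> + 1) > 0 \<and> Re c > 0 \<and>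
        c \<notin> \<int>\<^sub>\<le>\<^sub>0 \<and> b - (a + \<mu>) + 1 \<notin> \<int>\<^sub>\<le>\<^sub>0) \<longrightarrow>
      (\<forall>x\<in>({..<0} \<union> {1<..}).
         has_lebesgue_integral_on
           (\<lambda>y. of_real y powr (c - 1) * of_real (1 - y) powr (b - c - \<mu>) *
                 w1 y a b c * of_real \<bar>x - y\<bar> powr (\<mu> - 1))
           (Gamma (- a - \<mu> + 1) * Gamma (b - c - \<mu> + 1) * Gamma c *
             rGamma (b - a - \<mu> + 1) * rGamma (1 - \<mu>) *
             of_real \<bar>x\<bar> powr (c + \<mu> - 1) * of_real \<bar>x - 1\<bar> powr (b - c) *
             w4 x (a + \<mu>) b (c + \<mu>))
           {0<..<1})) \<and>
     ((Re (- a - \<mu> + 1) > 0 \<and> Re (b - c - \<mu> + 1) > 0 \<and> Re (a - b + 1) > 0 \<and>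
        a - b + 1 \<notin> \<int>\<^sub>\<le>\<^sub>0 \<and> 2 - (c + \<mu>) \<notin> \<int>\<^sub>\<le>\<^sub>0) \<longrightarrow>
      (\<forall>x\<in>({..<0} \<union> {0<..<1}).
         has_lebesgue_integral_on
           (\<lambda>y. of_real y powr (c - 1) * of_real (y - 1) powr (b - c - \<mu>) *
                 w3 y a b c * of_real (y - x) powr (\<mu> - 1))
           (Gamma (- a - \<mu> + 1) * Gamma (b - c - \<mu> + 1) * Gamma (a - b + 1) *
             rGamma (- c - \<mu> + 2) * rGamma (1 - \<mu>) *
             of_real \<bar>x\<bar> powr (c + \<mu> - 1) * of_real \<bar>x - 1\<bar> powr (b - c) *
             w2 x (a + \<mu>) b (c + \<mu>))
           {1<..})) \<and>
     ((Re (- b - \<mu> + 1) > 0 \<and> Re (a - c - \<mu> + 1) > 0 \<and> Re c > 0 \<and>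
        c \<notin> \<int>\<^sub>\<le>\<^sub>0 \<and> a - (b + \<mu>) + 1 \<notin> \<int>\<^sub>\<le>\<^sub>0) \<longrightarrow>
      (\<forall>x\<in>({..<0} \<union> {1<..}).
         has_lebesgue_integral_on
           (\<lambda>y. of_real y powr (c - 1) * of_real (1 - y) powr (a - c - \<mu>) *
                 w1 y a b c * of_real \<bar>x - y\<bar> powr (\<mu> - 1))
           (Gamma (- b - \<mu> + 1) * Gamma (a - c - \<mu> + 1) * Gamma c *
             rGamma (a - b - \<mu> + 1) * rGamma (1 - \<mu>) *
             of_real \<bar>x\<bar> powr (c + \<mu> - 1) * of_real \<bar>x - 1\<bar> powr (a - c) *
             w3 x a (b + \<mu>) (c + \<mu>))
           {0<..<1})) \<and>
     ((Re (- b - \<mu> + 1) > 0 \<and> Re (a - c - \<mu> + 1) > 0 \<and> Re (b - a + 1) > 0 \<and>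
        b - a + 1 \<notin> \<int>\<^sub>\<le>\<^sub>0 \<and> 2 - (c + \<mu>) \<notin> \<int>\<^sub>\<le>\<^sub>0) \<longrightarrow>
      (\<forall>x\<in>({..<0} \<union> {0<..<1}).
         has_lebesgue_integral_on
           (\<lambda>y. of_real y powr (c - 1) * of_real (y - 1) powr (a - c - \<mu>) *
                 w4 y a b c * of_real \<bar>x - y\<bar> powr (\<mu> - 1))
           (Gamma (- b - \<mu> + 1) * Gamma (a - c - \<mu> + 1) * Gamma (b - a + 1) *
             rGamma (- c - \<mu> + 2) * rGamma (1 - \<mu>) *
             of_real \<bar>x\<bar> powr (c + \<mu> - 1) * of_real \<bar>x - 1\<bar> powr (a - c) *
             w2 x a (b + \<mu>) (c + \<mu>))
           {1<..}))"
proof (intro conjI impI ballI)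
  fix x :: real
  assume "Re (- a - \<mu> + 1) > 0 \<and> Re (b - c - \<mu> + 1) > 0 \<and> Re c > 0 \<and>
        c \<notin> \<int>\<^sub>\<le>\<^sub>0 \<and> b - (a + \<mu>) + 1 \<notin> \<int>\<^sub>\<le>\<^sub>0" "x \<in> {..<0} \<union> {1<..}"
  thus "has_lebesgue_integral_on
           (\<lambda>y. of_real y powr (c - 1) * of_real (1 - y) powr (b - c - \<mu>) *
                 w1 y a b c * of_real \<bar>x - y\<bar> powr (\<mu> - 1))
           (Gamma (- a - \<mu> + 1) * Gamma (b - c - \<mu> + 1) * Gamma c *
             rGamma (b - a - \<mu> + 1) * rGamma (1 - \<mu>) *
             of_real \<bar>x\<bar> powr (c + \<mu> - 1) * of_real \<bar>x - 1\<bar> powr (b - c) *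
             w4 x (a + \<mu>) b (c + \<mu>))
           {0<..<1}"
    by (intro has_lebesgue_integral_w1) auto
next
  fix x :: real
  assume "Re (- a - \<mu> + 1) > 0 \<and> Re (b - c - \<mu> + 1) > 0 \<and> Re (a - b + 1) > 0 \<and>
        a - b + 1 \<notin> \<int>\<^sub>\<le>\<^sub>0 \<and> 2 - (c + \<mu>) \<notin> \<int>\<^sub>\<le>\<^sub>0" "x \<in> {..<0} \<union> {0<..<1}"
  thus "has_lebesgue_integral_on
           (\<lambda>y. of_real y powr (c - 1) * of_real (y - 1) powr (b - c - \<mu>) *
                 w3 y a b c * of_real (y - x) powr (\<mu> - 1))
           (Gamma (- a - \<mu> + 1) * Gamma (b - c - \<mu> + 1) * Gamma (a - b + 1) *
             rGamma (- c - \<mu> + 2) * rGamma (1 - \<mu>) *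
             of_real \<bar>x\<bar> powr (c + \<mu> - 1) * of_real \<bar>x - 1\<bar> powr (b - c) *
             w2 x (a + \<mu>) b (c + \<mu>))
           {1<..}"
    by (intro has_lebesgue_integral_w3) auto
next
  fix x :: real
  assume "Re (- b - \<mu> + 1) > 0 \<and> Re (a - c - \<mu> + 1) > 0 \<and> Re c > 0 \<and>
        c \<notin> \<int>\<^sub>\<le>\<^sub>0 \<and> a - (b + \<mu>) + 1 \<notin> \<int>\<^sub>\<le>\<^sub>0" "x \<in> {..<0} \<union> {1<..}"
  moreover have "w1 y a b c = w1 y b a c" for y by (simp add: w1_def hyp2F1_commute)
  moreover have "w3 x a (b + \<mu>) (c + \<mu>) = w4 x (b + \<mu>) a (c + \<mu>)" by (simp add: w3_def w4_def)
  ultimately show "has_lebesgue_integral_on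
           (\<lambda>y. of_real y powr (c - 1) * of_real (1 - y) powr (a - c - \<mu>) *
                 w1 y a b c * of_real \<bar>x - y\<bar> powr (\<mu> - 1))
           (Gamma (- b - \<mu> + 1) * Gamma (a - c - \<mu> + 1) * Gamma c *
             rGamma (a - b - \<mu> + 1) * rGamma (1 - \<mu>) *
             of_real \<bar>x\<bar> powr (c + \<mu> - 1) * of_real \<bar>x - 1\<bar> powr (a - c) *
             w3 x a (b + \<mu>) (c + \<mu>))
           {0<..<1}"
    using has_lebesgue_integral_w1[of b \<mu> a c x] by simp
next
  fix x :: real
  assume x: "Re (- b - \<mu> + 1) > 0 \<and> Re (a - c - \<mu> + 1) > 0 \<and> Re (b - a + 1) > 0 \<and>
        b - a + 1 \<notin> \<int>\<^sub>\<le>\<^sub>0 \<and> 2 - (c + \<mu>) \<notin> \<int>\<^sub>\<le>\<^sub>0" "x \<in> {..<0} \<union> {0<..<1}"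
  have "w4 y a b c = w3 y b a c" for y by (simp add: w3_def w4_def)
  moreover have "w2 x a (b + \<mu>) (c + \<mu>) = w2 x (b + \<mu>) a (c + \<mu>)" by (simp add: w2_def hyp2F1_commute)
  \<comment> \<open>On the range of integration y > 1 > x, so |x - y| is y - x and the two forms of
    the kernel agree.\<close>
  moreover have "has_lebesgue_integral_on
           (\<lambda>y. of_real y powr (c - 1) * of_real (y - 1) powr (a - c - \<mu>) *
                 w3 y b a c * of_real (y - x) powr (\<mu> - 1)) I {1<..} \<longleftrightarrow>
      has_lebesgue_integral_on
           (\<lambda>y. of_real y powr (c - 1) * of_real (y - 1) powr (a - c - \<mu>) *
                 w3 y b a c * of_real \<bar>x - y\<bar> powr (\<mu> - 1)) I {1<..}" for I
    unfolding has_lebesgue_integral_on_def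
    by (intro arg_cong2[where f = "(\<and>)"] set_integrable_cong arg_cong2[where f = "(=)"]
          set_lebesgue_integral_cong) (use x in auto)
  ultimately show "has_lebesgue_integral_on
           (\<lambda>y. of_real y powr (c - 1) * of_real (y - 1) powr (a - c - \<mu>) *
                 w4 y a b c * of_real \<bar>x - y\<bar> powr (\<mu> - 1))
           (Gamma (- b - \<mu> + 1) * Gamma (a - c - \<mu> + 1) * Gamma (b - a + 1) *
             rGamma (- c - \<mu> + 2) * rGamma (1 - \<mu>) *
             of_real \<bar>x\<bar> powr (c + \<mu> - 1) * of_real \<bar>x - 1\<bar> powr (a - c) *
             w2 x a (b + \<mu>) (c + \<mu>))
           {1<..}"
    using has_lebesgue_integral_w3[of b \<mu> a c x] x by simp
qed

end
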